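(* Consider the zero-sum case $U^1=-U^2=U$, and suppose there exists a bounded non-decreasing function $r:[0,\infty]\to\mathbb{R}_+$ with $\lim_{h\searrow 0}r(h)=r(0)=0$ such that $|U(s,t,\cdot)-U(s',t',\cdot)|\le r(|s-s'|+|t-t'|)$ for all $s,t,s',t'\in[0,\infty]$. For any $\epsilon>0$, let $\rho^\epsilon=(\rho_0^\epsilon,\rho_h)$ and $\tau^\epsilon=(\tau_0^\epsilon,\tau_h)$, where $(\rho_0^\epsilon,\tau_0^\epsilon)\in\mathcal{T}^2$ is an $\epsilon$-saddle point of the Dynkin game with payoff $V$ (first player maximizing, second minimizing), i.e. $$V(\rho_0,\tau_0^\epsilon)-\epsilon<V(\rho_0^\epsilon,\tau_0^\epsilon)<V(\rho_0^\epsilon,\tau_0)+\epsilon\qquad\text{for all }\rho_0,\tau_0\in\mathcal{T},$$ and $h>0$ is small enough that $$X_{\rho_0}>\mathbb{E}_{\rho_0}[U(\rho_0,\tau_h(\rho_0))]-2\epsilon\quad\text{and}\quad Y_{\tau_0}<\mathbb{E}_{\tau_0}[U(\rho_h(\tau_0),\tau_0)]+2\epsilon\qquad\text{for all }\rho_0,\tau_0\in\mathcal{T}.$$ Then $(\rho^\epsilon,\tau^\epsilon)$ is a $5\epsilon$-Nash equilibrium of the stopping game with payoffs $u^1,u^2$. Hence, in the zero-sum case, this stopping game has an $\epsilon$-Nash equilibrium for every $\epsilon>0$.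
   Context: $(\Omega,\mathcal{F},(\mathcal{F}_t)_{t\in[0,\infty]},\mathbb{P})$ is a filtered probability space whose filtration satisfies the usual conditions, with $\mathcal{F}=\mathcal{F}_\infty=\sigma(\bigcup_{t\in[0,\infty)}\mathcal{F}_t)$. $\Omega$ is at most countable and $\mathbb{P}$ is supported on $\Omega$ (every nonempty event has positive probability). $\mathcal{T}$ is the set of stopping times with values in $[0,\infty]$; for $\sigma\in\mathcal{T}$, $\mathcal{T}_\sigma$ (resp. $\mathcal{T}_{\sigma+}$) is the set of stopping times that are no less (resp. strictly greater) than $\sigma$, and $\mathbb{E}_\sigma[\cdot]:=\mathbb{E}[\cdot\,|\,\mathcal{F}_\sigma]$. $\mathbb{T}$ is the set of $\mathcal{B}([0,\infty])\otimes\mathcal{F}$-measurable maps $\phi:[0,\infty]\times\Omega\to[0,\infty]$ with $\phi(t,\cdot)\in\mathcal{T}_{t+}$ for every $t\in[0,\infty)$. For $\sigma\in\mathcal{T}$ and $\phi\in\mathbb{T}$, $\phi(\sigma):=\phi(\sigma(\cdot),\cdot)$. A stopping strategy is a pair $\rho=(\rho_0,\rho_1)$ with $\rho_0\in\mathcal{T}$, $\rho_1\in\mathbb{T}$; $\mathfrak{T}$ is the set of stopping strategies. For $\rho=(\rho_0,\rho_1),\tau=(\tau_0,\tau_1)\in\mathfrak{T}$, $\rho[\tau]:=\rho_0 1_{\{\rho_0\le\tau_0\}}+\rho_1(\tau_0)1_{\{\rho_0>\tau_0\}}$ (with $0\cdot\infty=0$), and $\tau[\rho]$ is defined by exchanging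 the roles of $\rho$ and $\tau$. $U:[0,\infty)\times[0,\infty)\times\Omega\to\mathbb{R}$ is bounded, $U(s,t)=U(s,t,\cdot)$ is $\mathcal{F}_{s\vee t}$-measurable for all $s,t$, and for $s,t\in[0,\infty)$ the limits $U(s,\infty):=\lim_{b\to\infty}U(s,b)$, $U(\infty,t):=\lim_{a\to\infty}U(a,t)$, $U(\infty,\infty):=\lim_{a,b\to\infty}U(a,b)$ are assumed to exist; these extend $U$ to $[0,\infty]^2\times\Omega$. Convention: $|\infty-\infty|=0$. Set $U^1=U$, $U^2=-U$. Game: $u^i(\rho,\tau)=\mathbb{E}[U^i(\rho[\tau],\tau[\rho])]$ for $\rho,\tau\in\mathfrak{T}$, $i=1,2$. For $\eta>0$, $(\rho^*,\tau^* )\in\mathfrak{T}^2$ is an $\eta$-Nash equilibrium if $u^1(\rho,\tau^* )\le u^1(\rho^*,\tau^* )+\eta$ and $u^2(\rho^*,\tau)\le u^2(\rho^*,\tau^* )+\eta$ for all $\rho,\tau\in\mathfrak{T}$. For $t\in[0,\infty]$: $X_t:=\inf_{\sigma\in\mathcal{T}_t}\mathbb{E}_t[U(t,\sigma)]$, $Y_t:=\sup_{\sigma\in\mathcal{T}_t}\mathbb{E}_t[U(\sigma,t)]$, $Z_t:=U(t,t)$; a subscript that is a stopping time means the process evaluated at it. For $\rho_0,\tau_0\in\mathcal{T}$, $$V(\rho_0,\tau_0):=\mathbb{E}\left[X_{\rho_0}1_{\{\rho_0<\tau_0\}}+Y_{\tau_0}1_{\{\rho_0>\tau_0\}}+Z_{\rho_0}1_{\{\rho_0=\tau_0\}}\right].$$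 Construction of $\rho_h,\tau_h\in\mathbb{T}$ for given $\epsilon>0$, $h>0$: for each $n\in\mathbb{N}$ let $\bar\rho(nh)\in\mathcal{T}_{nh}$ satisfy $\mathbb{E}_{nh}[U(\bar\rho(nh),nh)]\ge Y_{nh}-\epsilon$ and let $\bar\tau(nh)\in\mathcal{T}_{nh}$ satisfy $\mathbb{E}_{nh}[U(nh,\bar\tau(nh))]\le X_{nh}+\epsilon$. Put $\rho_h(t):=\bar\rho(([t/h]+1)h)$, $\tau_h(t):=\bar\tau(([t/h]+1)h)$ for $t\in[0,\infty)$ ($[\cdot]$ is the integer part) and $\rho_h(\infty)=\tau_h(\infty)=\infty$. *)

theory Defs
  imports "HOL-Probability.Probability"
begin

text \<open>
  Time is the type \<^typ>\<open>ennreal\<close>, that is $[0,\infty]$.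
\<close>

locale usual_filtered_prob_space =
  prob_space M + complete_measure M + filtration "space M" F
  for M :: "'a measure" and F :: "ennreal \<Rightarrow> 'a measure" +
  assumes null_sets_F0: "null_sets M \<subseteq> sets (F 0)"
    and right_continuous: "\<And>t. t < \<infinity> \<Longrightarrow> sets (F t) = (\<Inter>s\<in>{t<..}. sets (F s))"
    and sets_F_infinity: "sets (F \<infinity>) = sigma_sets (space M) (\<Union>t\<in>{..<\<infinity>}. sets (F t))"
    and sets_M: "sets M = sets (F \<infinity>)"

text \<open>
  The payoff is given directly on $[0,\infty]^2 \times \Omega$; the three limit conditions say
  that it is the extension of its restriction to finite times. The filter
  \<^term>\<open>at (\<infinity> :: ennreal)\<close> is punctured, so only finite times enter the limits.

  As no nonempty event is null, two functions that are measurable with respect to a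
  sub-sigma-algebra and almost surely equal agree at every point of the space. All statements
  about conditional expectations below are therefore made pointwise.
\<close>

locale stopping_game = usual_filtered_prob_space M F
  for M :: "'a measure" and F :: "ennreal \<Rightarrow> 'a measure" +
  fixes U :: "ennreal \<Rightarrow> ennreal \<Rightarrow> 'a \<Rightarrow> real"
  assumes countable_space: "countable (space M)"
    and full_support: "\<And>A. A \<in> sets M \<Longrightarrow> A \<noteq> {} \<Longrightarrow> 0 < prob A"
    and U_bounded: "\<exists>C. \<forall>s<\<infinity>. \<forall>t<\<infinity>. \<forall>\<omega>\<in>space M. \<bar>U s t \<omega>\<bar> \<le> C"
    and U_adapted: "\<And>s t. s < \<infinity> \<Longrightarrow> t < \<infinity> \<Longrightarrow> U s t \<in> borel_measurable (F (max s t))"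
    and U_lim_right: "\<And>s \<omega>. s < \<infinity> \<Longrightarrow> \<omega> \<in> space M \<Longrightarrow>
      ((\<lambda>b. U s b \<omega>) \<longlongrightarrow> U s \<infinity> \<omega>) (at \<infinity>)"
    and U_lim_left: "\<And>t \<omega>. t < \<infinity> \<Longrightarrow> \<omega> \<in> space M \<Longrightarrow>
      ((\<lambda>a. U a t \<omega>) \<longlongrightarrow> U \<infinity> t \<omega>) (at \<infinity>)"
    and U_lim_both: "\<And>\<omega>. \<omega> \<in> space M \<Longrightarrow>
      ((\<lambda>(a, b). U a b \<omega>) \<longlongrightarrow> U \<infinity> \<infinity> \<omega>) (at \<infinity> \<times>\<^sub>F at \<infinity>)"

text \<open>
  $|s - t|$ with the convention $|\infty - \infty| = 0$. The case distinction is needed because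
  \<^prop>\<open>(\<infinity> :: ennreal) - \<infinity> = \<infinity>\<close>.
\<close>

definition time_dist :: "ennreal \<Rightarrow> ennreal \<Rightarrow> ennreal" where
  "time_dist s t = (if s = t then 0 else max s t - min s t)"

definition stopping_times :: "(ennreal \<Rightarrow> 'a measure) \<Rightarrow> ('a \<Rightarrow> ennreal) set" where
  "stopping_times F = {\<sigma>. stopping_time F \<sigma>}"

definition stopping_times_ge ::
    "'a measure \<Rightarrow> (ennreal \<Rightarrow> 'a measure) \<Rightarrow> ('a \<Rightarrow> ennreal) \<Rightarrow> ('a \<Rightarrow> ennreal) set" where
  "stopping_times_ge M F \<sigma> = {\<tau> \<in> stopping_times F. \<forall>\<omega>\<in>space M. \<sigma> \<omega> \<le> \<tau> \<omega>}"

definition stopping_times_gt ::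
    "'a measure \<Rightarrow> (ennreal \<Rightarrow> 'a measure) \<Rightarrow> ('a \<Rightarrow> ennreal) \<Rightarrow> ('a \<Rightarrow> ennreal) set" where
  "stopping_times_gt M F \<sigma> = {\<tau> \<in> stopping_times F. \<forall>\<omega>\<in>space M. \<sigma> \<omega> < \<tau> \<omega>}"

definition stopping_maps ::
    "'a measure \<Rightarrow> (ennreal \<Rightarrow> 'a measure) \<Rightarrow> (ennreal \<Rightarrow> 'a \<Rightarrow> ennreal) set" where
  "stopping_maps M F =
    {\<phi>. (\<lambda>(t, \<omega>). \<phi> t \<omega>) \<in> borel_measurable (borel \<Otimes>\<^sub>M M) \<and>
        (\<forall>t<\<infinity>. \<phi> t \<in> stopping_times_gt M F (\<lambda>_. t))}"

type_synonym 'a strategy = "('a \<Rightarrow> ennreal) \<times> (ennreal \<Rightarrow> 'a \<Rightarrow> ennreal)"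

definition strategies :: "'a measure \<Rightarrow> (ennreal \<Rightarrow> 'a measure) \<Rightarrow> 'a strategy set" where
  "strategies M F = stopping_times F \<times> stopping_maps M F"

text \<open>
  \<open>outcome \<rho> \<tau>\<close> is $\rho[\tau]$, the time at which a player using \<open>\<rho>\<close> stops against \<open>\<tau>\<close>.
\<close>

definition outcome :: "'a strategy \<Rightarrow> 'a strategy \<Rightarrow> 'a \<Rightarrow> ennreal" where
  "outcome \<rho> \<tau> \<omega> = (if fst \<rho> \<omega> \<le> fst \<tau> \<omega> then fst \<rho> \<omega> else snd \<rho> (fst \<tau> \<omega>) \<omega>)"

definition game_payoff ::
    "'a measure \<Rightarrow> (ennreal \<Rightarrow> ennreal \<Rightarrow> 'a \<Rightarrow> real) \<Rightarrow> 'a strategy \<Rightarrow> 'a strategy \<Rightarrow> real" where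
  "game_payoff M W \<rho> \<tau> = (\<integral>\<omega>. W (outcome \<rho> \<tau> \<omega>) (outcome \<tau> \<rho> \<omega>) \<omega> \<partial>M)"

definition nash_equilibrium ::
    "'a measure \<Rightarrow> (ennreal \<Rightarrow> 'a measure) \<Rightarrow>
     (ennreal \<Rightarrow> ennreal \<Rightarrow> 'a \<Rightarrow> real) \<Rightarrow> (ennreal \<Rightarrow> ennreal \<Rightarrow> 'a \<Rightarrow> real) \<Rightarrow>
     real \<Rightarrow> 'a strategy \<Rightarrow> 'a strategy \<Rightarrow> bool" where
  "nash_equilibrium M F U1 U2 \<eta> \<rho>' \<tau>' \<longleftrightarrow>
    \<rho>' \<in> strategies M F \<and> \<tau>' \<in> strategies M F \<and>
    (\<forall>\<rho>\<in>strategies M F. game_payoff M U1 \<rho> \<tau>' \<le> game_payoff M U1 \<rho>' \<tau>' + \<eta>) \<and>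
    (\<forall>\<tau>\<in>strategies M F. game_payoff M U2 \<rho>' \<tau> \<le> game_payoff M U2 \<rho>' \<tau>' + \<eta>)"

text \<open>
  The processes $X$, $Y$ and $Z$. Infimum and supremum are taken pointwise: on a countable space
  without nonempty null events this coincides with the essential infimum and supremum.
\<close>

definition proc_X ::
    "'a measure \<Rightarrow> (ennreal \<Rightarrow> 'a measure) \<Rightarrow> (ennreal \<Rightarrow> ennreal \<Rightarrow> 'a \<Rightarrow> real) \<Rightarrow>
     ennreal \<Rightarrow> 'a \<Rightarrow> real" where
  "proc_X M F U t \<omega> =
    (INF \<sigma>\<in>stopping_times_ge M F (\<lambda>_. t). real_cond_exp M (F t) (\<lambda>\<omega>'. U t (\<sigma> \<omega>') \<omega>') \<omega>)"

definition proc_Y ::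
    "'a measure \<Rightarrow> (ennreal \<Rightarrow> 'a measure) \<Rightarrow> (ennreal \<Rightarrow> ennreal \<Rightarrow> 'a \<Rightarrow> real) \<Rightarrow>
     ennreal \<Rightarrow> 'a \<Rightarrow> real" where
  "proc_Y M F U t \<omega> =
    (SUP \<sigma>\<in>stopping_times_ge M F (\<lambda>_. t). real_cond_exp M (F t) (\<lambda>\<omega>'. U (\<sigma> \<omega>') t \<omega>') \<omega>)"

definition proc_Z :: "(ennreal \<Rightarrow> ennreal \<Rightarrow> 'a \<Rightarrow> real) \<Rightarrow> ennreal \<Rightarrow> 'a \<Rightarrow> real" where
  "proc_Z U t \<omega> = U t t \<omega>"

definition dynkin_payoff ::
    "'a measure \<Rightarrow> (ennreal \<Rightarrow> 'a measure) \<Rightarrow> (ennreal \<Rightarrow> ennreal \<Rightarrow> 'a \<Rightarrow> real) \<Rightarrow>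
     ('a \<Rightarrow> ennreal) \<Rightarrow> ('a \<Rightarrow> ennreal) \<Rightarrow> real" where
  "dynkin_payoff M F U \<rho>0 \<tau>0 =
    (\<integral>\<omega>. (if \<rho>0 \<omega> < \<tau>0 \<omega> then proc_X M F U (\<rho>0 \<omega>) \<omega>
          else if \<rho>0 \<omega> > \<tau>0 \<omega> then proc_Y M F U (\<tau>0 \<omega>) \<omega>
          else proc_Z U (\<rho>0 \<omega>) \<omega>) \<partial>M)"

definition dynkin_saddle_point ::
    "'a measure \<Rightarrow> (ennreal \<Rightarrow> 'a measure) \<Rightarrow> (ennreal \<Rightarrow> ennreal \<Rightarrow> 'a \<Rightarrow> real) \<Rightarrow>
     real \<Rightarrow> ('a \<Rightarrow> ennreal) \<Rightarrow> ('a \<Rightarrow> ennreal) \<Rightarrow> bool" where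
  "dynkin_saddle_point M F U \<epsilon> \<rho>' \<tau>' \<longleftrightarrow>
    \<rho>' \<in> stopping_times F \<and> \<tau>' \<in> stopping_times F \<and>
    (\<forall>\<rho>0\<in>stopping_times F. \<forall>\<tau>0\<in>stopping_times F.
      dynkin_payoff M F U \<rho>0 \<tau>' - \<epsilon> < dynkin_payoff M F U \<rho>' \<tau>' \<and>
      dynkin_payoff M F U \<rho>' \<tau>' < dynkin_payoff M F U \<rho>' \<tau>0 + \<epsilon>)"

text \<open>
  A family \<open>\<beta> n\<close> of stopping times stands for $\bar\rho(nh)$ or $\bar\tau(nh)$.
\<close>

definition near_maximizers ::
    "'a measure \<Rightarrow> (ennreal \<Rightarrow> 'a measure) \<Rightarrow> (ennreal \<Rightarrow> ennreal \<Rightarrow> 'a \<Rightarrow> real) \<Rightarrow>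
     real \<Rightarrow> real \<Rightarrow> (nat \<Rightarrow> 'a \<Rightarrow> ennreal) \<Rightarrow> bool" where
  "near_maximizers M F U \<epsilon> h \<beta> \<longleftrightarrow>
    (\<forall>n. let t = ennreal (real n * h) in
      \<beta> n \<in> stopping_times_ge M F (\<lambda>_. t) \<and>
      (\<forall>\<omega>\<in>space M. real_cond_exp M (F t) (\<lambda>\<omega>'. U (\<beta> n \<omega>') t \<omega>') \<omega> \<ge> proc_Y M F U t \<omega> - \<epsilon>))"

definition near_minimizers ::
    "'a measure \<Rightarrow> (ennreal \<Rightarrow> 'a measure) \<Rightarrow> (ennreal \<Rightarrow> ennreal \<Rightarrow> 'a \<Rightarrow> real) \<Rightarrow>
     real \<Rightarrow> real \<Rightarrow> (nat \<Rightarrow> 'a \<Rightarrow> ennreal) \<Rightarrow> bool" where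
  "near_minimizers M F U \<epsilon> h \<beta> \<longleftrightarrow>
    (\<forall>n. let t = ennreal (real n * h) in
      \<beta> n \<in> stopping_times_ge M F (\<lambda>_. t) \<and>
      (\<forall>\<omega>\<in>space M. real_cond_exp M (F t) (\<lambda>\<omega>'. U t (\<beta> n \<omega>') \<omega>') \<omega> \<le> proc_X M F U t \<omega> + \<epsilon>))"

definition grid_map :: "real \<Rightarrow> (nat \<Rightarrow> 'a \<Rightarrow> ennreal) \<Rightarrow> ennreal \<Rightarrow> 'a \<Rightarrow> ennreal" where
  "grid_map h \<beta> t \<omega> = (if t = \<infinity> then \<infinity> else \<beta> (nat \<lfloor>enn2real t / h\<rfloor> + 1) \<omega>)"

abbreviation cond_exp_at ::
    "'a measure \<Rightarrow> (ennreal \<Rightarrow> 'a measure) \<Rightarrow> ('a \<Rightarrow> ennreal) \<Rightarrow> ('a \<Rightarrow> real) \<Rightarrow> 'a \<Rightarrow> real" where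
  "cond_exp_at M F \<sigma> \<equiv> real_cond_exp M (filtration.pre_sigma (space M) F \<sigma>)"

end

theory Submission
  imports Defs
begin

text \<open>
  On a countable space without nonempty null events, conditional expectations are averages over
  the atoms of the conditioning $\sigma$-algebra. The atom of $\mathcal{F}_\sigma$ at $\omega$ is
  that of $\mathcal{F}_{\sigma(\omega)}$, so statements at stopping times reduce to statements at
  fixed times. Reacting optimally to an opponent who stops at $t$ is worth $X_t$ or $Y_t$, so playing
  $\rho_1$ and $\tau_1$ turns the game into the Dynkin game up to the reaction error.

  The Dynkin game is compared with its restriction to the times $0, h, \dots, Nh, \infty$. Since
  $X \le Z \le Y$, the restricted game is solved by the backward recursion
  $W_n = \max(X_n, \min(Y_n, \mathbb{E}_n[W_{n+1}]))$, the maximizer stopping once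
  $\mathbb{E}_n[W_{n+1}] < X_n$ and the minimizer once $\mathbb{E}_n[W_{n+1}] > Y_n$. Against a
  player restricted to the grid, rounding the opponent's stopping time up to the grid changes the
  payoff little: the order $X \le Z \le Y$ absorbs simultaneous stopping, the modulus of
  continuity controls one step of the grid, and the convergence of $U(\infty, t)$ and
  $U(t, \infty)$ controls the interval $(Nh, \infty)$. The minimizer's half of every statement is
  the maximizer's half for the payoff $(s, t) \mapsto - U(t, s)$.
\<close>

section \<open>Conditional expectation on a countable space without null events\<close>

text \<open>The modulus \<open>r\<close> gives no information on the step from a finite time to
  \<infinity>, since \<open>time_dist t \<infinity>\<close> is infinite for every finite t. The grid
  therefore has \<infinity> as a separate last point, and the passage to it relies on the joint
  limit of U at (\<infinity>, \<infinity>). That limit comes with no rate uniform in \<omega>, so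
  the error it causes is bounded only in expectation. For a saddle point it is enough that each
  player has a strategy guaranteeing nearly the same number against every opponent. Hence each grid
  strategy is tested against arbitrary stopping times, and the common number is the mean of
  \<open>W 0\<close>. The order of max and min in the recursion is immaterial because X \<le> Y. The
  factor 5 is 1 + 2 * 2: one \<epsilon> comes from the saddle point, and the reaction error 2 *
  \<epsilon> enters twice, once for the deviation and once for the equilibrium itself.\<close>

lemma (in prob_space) integrable_bounded:
  fixes f :: "'a \<Rightarrow> real"
  assumes "f \<in> borel_measurable M" "\<And>\<omega>. \<omega> \<in> space M \<Longrightarrow> \<bar>f \<omega>\<bar> \<le> C"
  shows "integrable M f"
  using assms by (intro integrable_const_bound[where B = C]) auto

locale countable_prob_space = prob_space M for M :: "'a measure" +
  assumes countable_space: "countable (space M)"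
    and full_support: "\<And>A. A \<in> sets M \<Longrightarrow> A \<noteq> {} \<Longrightarrow> 0 < prob A"
begin

text \<open>The exceptional set is covered by a null event, and under full support a null event is
  empty. This upgrades almost sure identities for conditional expectations to pointwise
  ones.\<close>

lemma AE_everywhere:
  assumes "AE \<omega> in M. P \<omega>" "\<omega> \<in> space M"
  shows "P \<omega>"
proof -
  obtain N where N: "{\<omega> \<in> space M. \<not> P \<omega>} \<subseteq> N" "emeasure M N = 0" "N \<in> sets M"
    using AE_E[OF assms(1)] by blast
  have "N = {}"
    using full_support[OF N(3)] N(2) by (auto simp: measure_def)
  then show ?thesis
    using N(1) assms(2) by auto
qed

section \<open>Atoms of a sub-sigma-algebra\<close>

definition atom :: "'a measure \<Rightarrow> 'a \<Rightarrow> 'a set" where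
  "atom G \<omega> = {\<omega>' \<in> space M. \<forall>A\<in>sets G. \<omega> \<in> A \<longrightarrow> \<omega>' \<in> A}"

lemma atom_self: "\<omega> \<in> space M \<Longrightarrow> \<omega> \<in> atom G \<omega>"
  by (simp add: atom_def)

lemma atom_least: "A \<in> sets G \<Longrightarrow> \<omega> \<in> A \<Longrightarrow> atom G \<omega> \<subseteq> A"
  by (auto simp: atom_def)

text \<open>An atom is an intersection of possibly uncountably many events. Each point outside it is
  excluded by a single event \<open>S \<omega>'\<close> that contains \<omega>, and since the space
  is countable these countably many events already cut out the atom.\<close>

lemma atom_sets:
  assumes G: "subalgebra M G" and \<omega>: "\<omega> \<in> space M"
  shows "atom G \<omega> \<in> sets G"
proof -
  have sp: "space G = space M"
    using G by (simp add: subalgebra_def)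
  define S where "S \<omega>' = (SOME A. A \<in> sets G \<and> \<omega> \<in> A \<and> \<omega>' \<notin> A)" for \<omega>'
  have S: "S \<omega>' \<in> sets G" "\<omega> \<in> S \<omega>'" "\<omega>' \<notin> S \<omega>'"
    if "\<omega>' \<in> space M - atom G \<omega>" for \<omega>'
  proof -
    have "\<exists>A. A \<in> sets G \<and> \<omega> \<in> A \<and> \<omega>' \<notin> A"
      using that by (auto simp: atom_def)
    from someI_ex[OF this] show "S \<omega>' \<in> sets G" "\<omega> \<in> S \<omega>'" "\<omega>' \<notin> S \<omega>'"
      by (simp_all add: S_def)
  qed
  have "(\<Union>\<omega>'\<in>space M - atom G \<omega>. space G - S \<omega>') \<in> sets G"
    using S by (intro sets.countable_UN'' countable_Diff countable_space) auto
  then have "space G - (\<Union>\<omega>'\<in>space M - atom G \<omega>. space G - S \<omega>') \<in> sets G"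
    by blast
  also have "space G - (\<Union>\<omega>'\<in>space M - atom G \<omega>. space G - S \<omega>') = atom G \<omega>"
  proof (intro equalityI subsetI)
    fix x assume "x \<in> space G - (\<Union>\<omega>'\<in>space M - atom G \<omega>. space G - S \<omega>')"
    then show "x \<in> atom G \<omega>"
      using S(3)[of x] by (auto simp: sp)
  next
    fix x assume x: "x \<in> atom G \<omega>"
    then have "x \<in> space G"
      by (simp add: atom_def sp)
    moreover have "x \<in> S \<omega>'" if "\<omega>' \<in> space M - atom G \<omega>" for \<omega>'
      using x S(1,2)[OF that] by (simp add: atom_def)
    ultimately show "x \<in> space G - (\<Union>\<omega>'\<in>space M - atom G \<omega>. space G - S \<omega>')"
      by blast
  qed
  finally show ?thesis .
qed

text \<open>If \<omega> were outside the atom of \<omega>', the complement of that atom would be an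
  event containing \<omega> but not \<omega>'. So atoms partition the space.\<close>

lemma atom_eq:
  assumes G: "subalgebra M G" and \<omega>: "\<omega> \<in> space M" and \<omega>': "\<omega>' \<in> atom G \<omega>"
  shows "atom G \<omega>' = atom G \<omega>"
proof -
  have \<omega>'M: "\<omega>' \<in> space M"
    using \<omega>' by (simp add: atom_def)
  have "\<omega> \<in> atom G \<omega>'"
  proof (rule ccontr)
    assume n: "\<omega> \<notin> atom G \<omega>'"
    have "space M - atom G \<omega>' \<in> sets G"
      using atom_sets[OF G \<omega>'M] G by (metis sets.compl_sets subalgebra_def)
    then have "atom G \<omega> \<subseteq> space M - atom G \<omega>'"
      using n \<omega> by (intro atom_least) auto
    then show False
      using \<omega>' atom_self[OF \<omega>'M] by blast
  qed
  then show ?thesis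
    using atom_least[OF atom_sets[OF G \<omega>]] atom_least[OF atom_sets[OF G \<omega>'M]] \<omega>' by blast
qed

text \<open>A preimage is a union of atoms, and countably many suffice. No property of
  \<open>f\<close> beyond constancy on atoms enters, so the criterion also covers suprema over
  uncountable families.\<close>

lemma measurable_constant_on_atoms:
  assumes G: "subalgebra M G"
    and f: "\<And>\<omega> \<omega>'. \<omega> \<in> space M \<Longrightarrow> \<omega>' \<in> atom G \<omega> \<Longrightarrow> f \<omega>' = f \<omega>"
    and N: "\<And>\<omega>. \<omega> \<in> space M \<Longrightarrow> f \<omega> \<in> space N"
  shows "f \<in> measurable G N"
proof (rule measurableI)
  have sp: "space G = space M"
    using G by (simp add: subalgebra_def)
  show "f \<omega> \<in> space N" if "\<omega> \<in> space G" for \<omega>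
    using N that by (simp add: sp)
  fix B assume "B \<in> sets N"
  have "(\<Union>\<omega>\<in>f -` B \<inter> space G. atom G \<omega>) \<in> sets G"
    using atom_sets[OF G]
    by (intro sets.countable_UN'' countable_subset[OF _ countable_space]) (auto simp: sp)
  also have "(\<Union>\<omega>\<in>f -` B \<inter> space G. atom G \<omega>) = f -` B \<inter> space G"
  proof (intro equalityI subsetI)
    fix x assume "x \<in> (\<Union>\<omega>\<in>f -` B \<inter> space G. atom G \<omega>)"
    then obtain \<omega> where \<omega>: "f \<omega> \<in> B" "\<omega> \<in> space M" "x \<in> atom G \<omega>"
      by (auto simp: sp)
    then show "x \<in> f -` B \<inter> space G"
      using f[OF \<omega>(2,3)] by (simp add: sp atom_def)
  next
    fix x assume x: "x \<in> f -` B \<inter> space G"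
    then have "x \<in> atom G x"
      by (simp add: atom_self sp)
    with x show "x \<in> (\<Union>\<omega>\<in>f -` B \<inter> space G. atom G \<omega>)"
      by blast
  qed
  finally show "f -` B \<inter> space G \<in> sets G" .
qed

text \<open>On a countable space \<sigma> has countably many values, so no joint measurability in
  time and \<omega> is required.\<close>

lemma measurable_at_time:
  fixes \<sigma> :: "'a \<Rightarrow> 't::{t2_space, second_countable_topology}"
  assumes f: "\<And>t. f t \<in> measurable M N" and \<sigma>: "\<sigma> \<in> borel_measurable M"
  shows "(\<lambda>\<omega>. f (\<sigma> \<omega>) \<omega>) \<in> measurable M N"
proof (rule measurable_compose_countable'[OF f])
  show "countable (\<sigma> ` space M)"
    using countable_space by blast
  then show "\<sigma> \<in> measurable M (count_space (\<sigma> ` space M))"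
    using \<sigma> by (subst measurable_count_space_eq_countable) (auto simp: measurable_sets)
qed

end

section \<open>Conditional expectations as averages over atoms\<close>

locale countable_subalgebra = countable_prob_space +
  fixes G
  assumes subalg: "subalgebra M G"

sublocale countable_subalgebra \<subseteq> finite_measure_subalgebra M G
  by unfold_locales (rule subalg)

context countable_subalgebra
begin

abbreviation ce :: "('a \<Rightarrow> real) \<Rightarrow> 'a \<Rightarrow> real" where
  "ce \<equiv> real_cond_exp M G"

lemma atom_sets_M: "\<omega> \<in> space M \<Longrightarrow> atom G \<omega> \<in> sets M"
  using atom_sets[OF subalg] subalg by (auto simp: subalgebra_def)

lemma measurable_const_atom:
  assumes "f \<in> borel_measurable G" "\<omega> \<in> space M" "\<omega>' \<in> atom G \<omega>"
  shows "f \<omega>' = (f \<omega> :: real)"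
proof -
  have "f -` {f \<omega>} \<inter> space G \<in> sets G"
    using assms(1) by (simp add: measurable_sets)
  from atom_least[OF this, of \<omega>] show ?thesis
    using assms(2,3) subalg by (auto simp: subalgebra_def)
qed

text \<open>The conditional expectation is constant on the atom, so its integral there is its value
  times the probability of the atom. Since that probability is positive, the value at \<omega> is
  the mean of \<open>f\<close> over the atom.\<close>

lemma ce_atom:
  assumes f: "integrable M f" and \<omega>: "\<omega> \<in> space M"
  shows "ce f \<omega> * prob (atom G \<omega>) = (\<integral>\<omega>'\<in>atom G \<omega>. f \<omega>' \<partial>M)"
proof -
  have "(\<integral>\<omega>'\<in>atom G \<omega>. f \<omega>' \<partial>M) = (\<integral>\<omega>'\<in>atom G \<omega>. ce f \<omega>' \<partial>M)"
    by (rule real_cond_exp_intA[OF f atom_sets[OF subalg \<omega>]])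
  also have "\<dots> = (\<integral>\<omega>'\<in>atom G \<omega>. ce f \<omega> \<partial>M)"
    using measurable_const_atom[OF borel_measurable_cond_exp \<omega>] atom_sets_M[OF \<omega>]
    by (intro set_lebesgue_integral_cong) auto
  also have "\<dots> = ce f \<omega> * prob (atom G \<omega>)"
    using atom_sets_M[OF \<omega>] by (subst set_integral_const) auto
  finally show ?thesis ..
qed

lemma prob_atom_pos: "\<omega> \<in> space M \<Longrightarrow> 0 < prob (atom G \<omega>)"
  using full_support[OF atom_sets_M] atom_self by blast

text \<open>The comparison is required only on the atom of \<omega>. This locality is what later
  permits a stopping time to be frozen at its value at \<omega>.\<close>

lemma ce_mono:
  assumes f: "integrable M f" and g: "integrable M g" and \<omega>: "\<omega> \<in> space M"
    and le: "\<And>\<omega>'. \<omega>' \<in> atom G \<omega> \<Longrightarrow> f \<omega>' \<le> g \<omega>'"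
  shows "ce f \<omega> \<le> ce g \<omega>"
proof -
  have "(\<integral>\<omega>'\<in>atom G \<omega>. f \<omega>' \<partial>M) \<le> (\<integral>\<omega>'\<in>atom G \<omega>. g \<omega>' \<partial>M)"
    using integrable_mult_indicator[OF atom_sets_M[OF \<omega>] f]
      integrable_mult_indicator[OF atom_sets_M[OF \<omega>] g] le
    by (intro set_integral_mono) (auto simp: set_integrable_def)
  then show ?thesis
    using prob_atom_pos[OF \<omega>] by (simp flip: ce_atom[OF f \<omega>] ce_atom[OF g \<omega>])
qed

lemma ce_cong:
  assumes "integrable M f" "integrable M g" "\<omega> \<in> space M"
    and "\<And>\<omega>'. \<omega>' \<in> atom G \<omega> \<Longrightarrow> f \<omega>' = g \<omega>'"
  shows "ce f \<omega> = ce g \<omega>"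
  using assms by (intro antisym ce_mono) auto

lemma ce_measurable:
  assumes "integrable M f" "f \<in> borel_measurable G" "\<omega> \<in> space M"
  shows "ce f \<omega> = f \<omega>"
  using AE_everywhere[OF real_cond_exp_F_meas[OF assms(1,2)] assms(3)] .

lemma ce_add:
  assumes "integrable M f" "integrable M g" "\<omega> \<in> space M"
  shows "ce (\<lambda>\<omega>. f \<omega> + g \<omega>) \<omega> = ce f \<omega> + ce g \<omega>"
  using AE_everywhere[OF real_cond_exp_add[OF assms(1,2)] assms(3)] .

lemma ce_const: "\<omega> \<in> space M \<Longrightarrow> ce (\<lambda>_. c) \<omega> = c"
  by (rule ce_measurable) auto

lemma ce_add_const:
  assumes "integrable M f" "\<omega> \<in> space M"
  shows "ce (\<lambda>\<omega>. f \<omega> + c) \<omega> = ce f \<omega> + c"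
  using ce_add[OF assms(1) integrable_const assms(2)] ce_const[OF assms(2)] by simp

lemma ce_minus:
  assumes "integrable M f" "\<omega> \<in> space M"
  shows "ce (\<lambda>\<omega>. - f \<omega>) \<omega> = - ce f \<omega>"
  using AE_everywhere[OF real_cond_exp_cmult[OF assms(1), of "-1"] assms(2)] by simp

lemma ce_abs_bound:
  assumes f: "f \<in> borel_measurable M" and \<omega>: "\<omega> \<in> space M"
    and C: "\<And>\<omega>. \<omega> \<in> space M \<Longrightarrow> \<bar>f \<omega>\<bar> \<le> C"
  shows "\<bar>ce f \<omega>\<bar> \<le> C"
proof -
  have i: "integrable M f"
    by (rule integrable_bounded[OF f C])
  have at: "\<omega>' \<in> space M" if "\<omega>' \<in> atom G \<omega>" for \<omega>'
    using that by (simp add: atom_def)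
  have "ce f \<omega> \<le> ce (\<lambda>_. C) \<omega>" "ce (\<lambda>_. - C) \<omega> \<le> ce f \<omega>"
    using C[OF at] by (intro ce_mono i \<omega>; fastforce simp: abs_le_iff)+
  then show ?thesis
    by (simp add: ce_const[OF \<omega>] abs_le_iff)
qed

lemma ce_tower:
  assumes H: "subalgebra M H" "sets G \<subseteq> sets H" and f: "integrable M f" and \<omega>: "\<omega> \<in> space M"
  shows "ce (real_cond_exp M H f) \<omega> = ce f \<omega>"
proof -
  have "subalgebra H G"
    using H subalg by (auto simp: subalgebra_def)
  from AE_everywhere[OF real_cond_exp_nested_subalg[OF H(1) this f] \<omega>] show ?thesis .
qed

end

section \<open>Stopping games on a countable space\<close>

sublocale stopping_game \<subseteq> countable_prob_space M
  by unfold_locales (rule countable_space full_support; assumption)+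

context stopping_game
begin

lemma subalgebra_F: "subalgebra M (F t)"
  using sets_F_mono[of t \<infinity>] by (simp add: subalgebra_def space_F sets_M)

lemma subalgebra_pre_sigma:
  assumes "stopping_time F \<sigma>"
  shows "subalgebra M (pre_sigma \<sigma>)"
proof -
  have "A \<in> sets M" if "A \<in> sets (pre_sigma \<sigma>)" for A
    using sets_pre_sigmaD[OF assms that, of \<infinity>] by (simp add: sets_M)
  then show ?thesis
    by (auto simp: subalgebra_def space_pre_sigma)
qed

end

sublocale stopping_game \<subseteq> at_time: countable_subalgebra M "F t" for t
  by unfold_locales (rule subalgebra_F)

context stopping_game
begin

abbreviation cexp :: "ennreal \<Rightarrow> ('a \<Rightarrow> real) \<Rightarrow> 'a \<Rightarrow> real" where
  "cexp t \<equiv> real_cond_exp M (F t)"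

abbreviation times_from :: "ennreal \<Rightarrow> ('a \<Rightarrow> ennreal) set" where
  "times_from t \<equiv> stopping_times_ge M F (\<lambda>_. t)"

abbreviation X :: "ennreal \<Rightarrow> 'a \<Rightarrow> real" where "X \<equiv> proc_X M F U"
abbreviation Y :: "ennreal \<Rightarrow> 'a \<Rightarrow> real" where "Y \<equiv> proc_Y M F U"
abbreviation V :: "('a \<Rightarrow> ennreal) \<Rightarrow> ('a \<Rightarrow> ennreal) \<Rightarrow> real" where
  "V \<equiv> dynkin_payoff M F U"

lemma measurable_from_F: "f \<in> measurable (F t) N \<Longrightarrow> f \<in> measurable M N"
  by (rule measurable_from_subalg[OF subalgebra_F])

lemma stopping_time_measurable: "stopping_time F \<sigma> \<Longrightarrow> \<sigma> \<in> borel_measurable M"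
  using subalgebra_F by (intro measurable_stopping_time[where F = F]) (auto simp: subalgebra_def)

lemma const_times_from: "t \<le> s \<Longrightarrow> (\<lambda>_. s) \<in> times_from t"
  by (simp add: stopping_times_ge_def stopping_times_def stopping_time_const)

lemma times_from_mono: "s \<le> t \<Longrightarrow> times_from t \<subseteq> times_from s"
  by (auto simp: stopping_times_ge_def intro: order_trans)

section \<open>Reduction from stopping times to fixed times\<close>

lemma stopping_time_const_on_atom:
  assumes \<sigma>: "stopping_time F \<sigma>" and \<omega>: "\<omega> \<in> space M" and "\<omega>' \<in> atom (F (\<sigma> \<omega>)) \<omega>"
  shows "\<sigma> \<omega>' = \<sigma> \<omega>"
proof -
  have "{x \<in> space (F (\<sigma> \<omega>)). \<sigma> x = \<sigma> \<omega>} \<in> sets (F (\<sigma> \<omega>))"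
    using stopping_time_eq_const[OF \<sigma>] by (simp add: pred_def)
  from atom_least[OF this, of \<omega>] show ?thesis
    using assms by (auto simp: space_F)
qed

text \<open>On the atom of \<open>F (\<sigma> \<omega>)\<close> the time \<sigma> is constant, so
  its trace on {\<sigma> \<le> t} is everything or nothing and it belongs to
  \<open>pre_sigma \<sigma>\<close>. Conversely, an event B of \<open>pre_sigma \<sigma>\<close>
  containing \<omega> yields B \<inter> {\<sigma> \<le> \<sigma> \<omega>}, an event of
  \<open>F (\<sigma> \<omega>)\<close> containing \<omega>.\<close>

lemma atom_pre_sigma:
  assumes \<sigma>: "stopping_time F \<sigma>" and \<omega>: "\<omega> \<in> space M"
  shows "atom (pre_sigma \<sigma>) \<omega> = atom (F (\<sigma> \<omega>)) \<omega>"
proof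
  define A where "A = atom (F (\<sigma> \<omega>)) \<omega>"
  have A: "A \<in> sets (F (\<sigma> \<omega>))"
    unfolding A_def by (rule atom_sets[OF subalgebra_F \<omega>])
  have eq: "\<sigma> x = \<sigma> \<omega>" if "x \<in> A" for x
    using stopping_time_const_on_atom[OF \<sigma> \<omega>] that by (simp add: A_def)
  have "{x \<in> A. \<sigma> x \<le> t} \<in> sets (F t)" for t
  proof (cases "\<sigma> \<omega> \<le> t")
    case True
    then have "{x \<in> A. \<sigma> x \<le> t} = A"
      using eq by auto
    then show ?thesis
      using A sets_F_mono[OF True] by auto
  next
    case False
    then have "{x \<in> A. \<sigma> x \<le> t} = {}"
      using eq by auto
    then show ?thesis
      by (simp only: sets.empty_sets)
  qed
  then have "A \<in> sets (pre_sigma \<sigma>)"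
    by (rule sets_pre_sigmaI[OF \<sigma>])
  then show "atom (pre_sigma \<sigma>) \<omega> \<subseteq> atom (F (\<sigma> \<omega>)) \<omega>"
    unfolding A_def using \<omega> by (intro atom_least atom_self)
  show "atom (F (\<sigma> \<omega>)) \<omega> \<subseteq> atom (pre_sigma \<sigma>) \<omega>"
  proof
    fix x assume x: "x \<in> atom (F (\<sigma> \<omega>)) \<omega>"
    have "x \<in> B" if "B \<in> sets (pre_sigma \<sigma>)" "\<omega> \<in> B" for B
      using atom_least[OF sets_pre_sigmaD[OF \<sigma> that(1), of "\<sigma> \<omega>"], of \<omega>] x that(2) by auto
    then show "x \<in> atom (pre_sigma \<sigma>) \<omega>"
      using x unfolding atom_def by blast
  qed
qed

lemma cexp_pre_sigma:
  assumes \<sigma>: "stopping_time F \<sigma>" and f: "integrable M f" and \<omega>: "\<omega> \<in> space M"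
  shows "real_cond_exp M (pre_sigma \<sigma>) f \<omega> = cexp (\<sigma> \<omega>) f \<omega>"
proof -
  interpret S: countable_subalgebra M "pre_sigma \<sigma>"
    by unfold_locales (rule subalgebra_pre_sigma[OF \<sigma>])
  show ?thesis
    using S.ce_atom[OF f \<omega>] at_time.ce_atom[OF f \<omega>, of "\<sigma> \<omega>"] at_time.prob_atom_pos[OF \<omega>, of "\<sigma> \<omega>"]
    unfolding atom_pre_sigma[OF \<sigma> \<omega>] by (metis mult_right_cancel less_irrefl)
qed

lemma set_integral_at_stopping_time_mono:
  assumes \<sigma>: "stopping_time F \<sigma>" and B: "B \<in> sets (pre_sigma \<sigma>)"
    and f: "\<And>t. integrable M (f t)" "integrable M (\<lambda>\<omega>. f (\<sigma> \<omega>) \<omega>)"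
    and g: "integrable M (\<lambda>\<omega>. g (\<sigma> \<omega>) \<omega>)"
    and le: "\<And>\<omega>. \<omega> \<in> B \<Longrightarrow> cexp (\<sigma> \<omega>) (f (\<sigma> \<omega>)) \<omega> \<le> g (\<sigma> \<omega>) \<omega>"
  shows "(\<integral>\<omega>\<in>B. f (\<sigma> \<omega>) \<omega> \<partial>M) \<le> (\<integral>\<omega>\<in>B. g (\<sigma> \<omega>) \<omega> \<partial>M)"
proof -
  interpret S: countable_subalgebra M "pre_sigma \<sigma>"
    by unfold_locales (rule subalgebra_pre_sigma[OF \<sigma>])
  have BM: "B \<in> sets M"
    using B S.subalg by (auto simp: subalgebra_def)
  have "(\<integral>\<omega>\<in>B. f (\<sigma> \<omega>) \<omega> \<partial>M) = (\<integral>\<omega>\<in>B. S.ce (\<lambda>\<omega>. f (\<sigma> \<omega>) \<omega>) \<omega> \<partial>M)"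
    by (rule S.real_cond_exp_intA[OF f(2) B])
  also have "\<dots> \<le> (\<integral>\<omega>\<in>B. g (\<sigma> \<omega>) \<omega> \<partial>M)"
  proof (rule set_integral_mono)
    show "set_integrable M B (S.ce (\<lambda>\<omega>. f (\<sigma> \<omega>) \<omega>))"
      unfolding set_integrable_def by (intro integrable_mult_indicator BM S.real_cond_exp_int f)
    show "set_integrable M B (\<lambda>\<omega>. g (\<sigma> \<omega>) \<omega>)"
      unfolding set_integrable_def by (intro integrable_mult_indicator BM g)
    fix \<omega> assume "\<omega> \<in> B"
    then have \<omega>: "\<omega> \<in> space M"
      using sets.sets_into_space[OF BM] by auto
    have "S.ce (\<lambda>\<omega>. f (\<sigma> \<omega>) \<omega>) \<omega> = cexp (\<sigma> \<omega>) (\<lambda>\<omega>. f (\<sigma> \<omega>) \<omega>) \<omega>"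
      by (rule cexp_pre_sigma[OF \<sigma> f(2) \<omega>])
    also have "\<dots> = cexp (\<sigma> \<omega>) (f (\<sigma> \<omega>)) \<omega>"
      using stopping_time_const_on_atom[OF \<sigma> \<omega>] by (intro at_time.ce_cong f \<omega>) auto
    finally show "S.ce (\<lambda>\<omega>. f (\<sigma> \<omega>) \<omega>) \<omega> \<le> g (\<sigma> \<omega>) \<omega>"
      using le[OF \<open>\<omega> \<in> B\<close>] by simp
  qed
  finally show ?thesis .
qed

section \<open>Boundedness and measurability of the payoff up to infinite times\<close>

lemma of_nat_at_infinity: "filterlim (of_nat :: nat \<Rightarrow> ennreal) (at \<infinity>) sequentially"
  using of_nat_tendsto_top_ennreal by (auto simp: filterlim_at)

definition U_bound :: real where
  "U_bound = (SOME C. \<forall>s<\<infinity>. \<forall>t<\<infinity>. \<forall>\<omega>\<in>space M. \<bar>U s t \<omega>\<bar> \<le> C)"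

text \<open>Integer times are finite and tend to \<infinity>, so every value of U at an infinite
  argument is the limit of a sequence of values at finite times. Bounds and measurability then pass
  to the limit.\<close>

lemma U_limits:
  assumes "\<omega> \<in> space M"
  shows "s < \<infinity> \<Longrightarrow> (\<lambda>n. U s (of_nat n) \<omega>) \<longlonglongrightarrow> U s \<infinity> \<omega>"
    and "t < \<infinity> \<Longrightarrow> (\<lambda>n. U (of_nat n) t \<omega>) \<longlonglongrightarrow> U \<infinity> t \<omega>"
    and "(\<lambda>n. U (of_nat n) (of_nat n) \<omega>) \<longlonglongrightarrow> U \<infinity> \<infinity> \<omega>"
proof -
  show "s < \<infinity> \<Longrightarrow> (\<lambda>n. U s (of_nat n) \<omega>) \<longlonglongrightarrow> U s \<infinity> \<omega>"
    using filterlim_compose[OF U_lim_right of_nat_at_infinity] assms by simp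
  show "t < \<infinity> \<Longrightarrow> (\<lambda>n. U (of_nat n) t \<omega>) \<longlonglongrightarrow> U \<infinity> t \<omega>"
    using filterlim_compose[OF U_lim_left of_nat_at_infinity] assms by simp
  show "(\<lambda>n. U (of_nat n) (of_nat n) \<omega>) \<longlonglongrightarrow> U \<infinity> \<infinity> \<omega>"
    using filterlim_compose[OF U_lim_both filterlim_Pair[OF of_nat_at_infinity of_nat_at_infinity]] assms
    by simp
qed

lemma ennreal_cases_infinity: "(t :: ennreal) < \<infinity> \<or> t = \<infinity>"
  by (metis less_top infinity_ennreal_def)

lemma abs_U_le:
  assumes \<omega>: "\<omega> \<in> space M"
  shows "\<bar>U s t \<omega>\<bar> \<le> U_bound"
proof -
  have fin: "\<bar>U s t \<omega>\<bar> \<le> U_bound" if "s < \<infinity>" "t < \<infinity>" for s t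
    using someI_ex[OF U_bounded] that \<omega> unfolding U_bound_def by blast
  have n: "of_nat n < (\<infinity> :: ennreal)" for n
    using of_nat_less_top by simp
  note lim = U_limits[OF \<omega>]
  consider "s < \<infinity>" "t < \<infinity>" | "s < \<infinity>" "t = \<infinity>" | "s = \<infinity>" "t < \<infinity>" | "s = \<infinity>" "t = \<infinity>"
    using ennreal_cases_infinity[of s] ennreal_cases_infinity[of t] by blast
  then show ?thesis
  proof cases
    case 2
    then show ?thesis
      using fin[OF 2(1) n] by (intro tendsto_upperbound[OF tendsto_rabs[OF lim(1)[OF 2(1)], folded 2(2)]]) auto
  next
    case 3
    then show ?thesis
      using fin[OF n 3(2)] by (intro tendsto_upperbound[OF tendsto_rabs[OF lim(2)[OF 3(2)], folded 3(1)]]) auto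
  next
    case 4
    then show ?thesis
      using tendsto_upperbound[OF tendsto_rabs[OF lim(3)], of U_bound] fin[OF n n] by auto
  qed (rule fin)
qed

lemma U_measurable: "U s t \<in> borel_measurable M"
proof -
  have fin: "U s t \<in> borel_measurable M" if "s < \<infinity>" "t < \<infinity>" for s t
    using measurable_from_F[OF U_adapted[OF that]] .
  have n: "of_nat n < (\<infinity> :: ennreal)" for n
    using of_nat_less_top by simp
  consider "s < \<infinity>" "t < \<infinity>" | "s < \<infinity>" "t = \<infinity>" | "s = \<infinity>" "t < \<infinity>" | "s = \<infinity>" "t = \<infinity>"
    using ennreal_cases_infinity[of s] ennreal_cases_infinity[of t] by blast
  then show ?thesis
  proof cases
    case 2
    show ?thesis
      unfolding 2(2) by (rule borel_measurable_LIMSEQ_metric[OF fin[OF 2(1) n] U_limits(1)[OF _ 2(1)]])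
  next
    case 3
    show ?thesis
      unfolding 3(1) by (rule borel_measurable_LIMSEQ_metric[OF fin[OF n 3(2)] U_limits(2)[OF _ 3(2)]])
  next
    case 4
    show ?thesis
      unfolding 4 by (rule borel_measurable_LIMSEQ_metric[OF fin[OF n n] U_limits(3)])
  qed (rule fin)
qed

lemma U_at_measurable:
  assumes "\<sigma> \<in> borel_measurable M" "\<tau> \<in> borel_measurable M"
  shows "(\<lambda>\<omega>. U (\<sigma> \<omega>) (\<tau> \<omega>) \<omega>) \<in> borel_measurable M"
  by (rule measurable_at_time[where f = "\<lambda>s \<omega>. U s (\<tau> \<omega>) \<omega>",
        OF measurable_at_time[OF U_measurable assms(2)] assms(1)])

lemma U_at_integrable:
  assumes "\<sigma> \<in> borel_measurable M" "\<tau> \<in> borel_measurable M"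
  shows "integrable M (\<lambda>\<omega>. U (\<sigma> \<omega>) (\<tau> \<omega>) \<omega>)"
  by (rule integrable_bounded[OF U_at_measurable[OF assms] abs_U_le])

lemma Z_adapted: "U t t \<in> borel_measurable (F t)"
proof (cases "t = \<infinity>")
  case True
  have "measurable (F \<infinity>) borel = measurable M (borel :: real measure)"
    by (rule measurable_cong_sets) (simp_all add: sets_M)
  then show ?thesis
    using U_measurable[of t t] True by simp
next
  case False
  then show ?thesis
    using U_adapted[of t t] ennreal_cases_infinity[of t] by simp
qed

lemma times_from_measurable: "\<sigma> \<in> times_from t \<Longrightarrow> \<sigma> \<in> borel_measurable M"
  by (intro stopping_time_measurable) (simp add: stopping_times_ge_def stopping_times_def)

lemma U_from_integrable:
  "\<sigma> \<in> times_from t \<Longrightarrow> integrable M (\<lambda>\<omega>. U (\<sigma> \<omega>) s \<omega>)"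
  using U_at_integrable times_from_measurable by auto

lemma cexp_U_bound:
  assumes "\<sigma> \<in> borel_measurable M" "\<tau> \<in> borel_measurable M" "\<omega> \<in> space M"
  shows "\<bar>cexp t (\<lambda>\<omega>. U (\<sigma> \<omega>) (\<tau> \<omega>) \<omega>) \<omega>\<bar> \<le> U_bound"
  by (rule at_time.ce_abs_bound[OF U_at_measurable[OF assms(1,2)] assms(3) abs_U_le])

section \<open>The reaction value Y\<close>

lemma bdd_cexp_U:
  assumes "\<omega> \<in> space M"
  shows "bdd_above ((\<lambda>\<sigma>. cexp t (\<lambda>\<omega>'. U (\<sigma> \<omega>') t \<omega>') \<omega>) ` times_from t)"
  using cexp_U_bound[OF times_from_measurable _ assms, of _ t "\<lambda>_. t" t]
  by (intro bdd_aboveI2[where M = U_bound]) (fastforce simp: abs_le_iff)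

lemma cexp_le_Y:
  assumes "\<sigma> \<in> times_from t" "\<omega> \<in> space M"
  shows "cexp t (\<lambda>\<omega>'. U (\<sigma> \<omega>') t \<omega>') \<omega> \<le> Y t \<omega>"
  unfolding proc_Y_def by (rule cSUP_upper[OF assms(1) bdd_cexp_U[OF assms(2)]])

lemma times_from_nonempty: "times_from t \<noteq> {}"
  using const_times_from[of t t] by auto

lemma Y_le:
  assumes "\<And>\<sigma>. \<sigma> \<in> times_from t \<Longrightarrow> cexp t (\<lambda>\<omega>'. U (\<sigma> \<omega>') t \<omega>') \<omega> \<le> c"
  shows "Y t \<omega> \<le> c"
  unfolding proc_Y_def by (rule cSUP_least[OF times_from_nonempty assms])

lemma Z_le_Y:
  assumes "\<omega> \<in> space M"
  shows "U t t \<omega> \<le> Y t \<omega>"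
proof -
  have "cexp t (U t t) \<omega> = U t t \<omega>"
    by (intro at_time.ce_measurable integrable_bounded[OF U_measurable abs_U_le] Z_adapted assms)
  then show ?thesis
    using cexp_le_Y[OF const_times_from[of t t] assms] by simp
qed

lemma abs_Y_le:
  assumes \<omega>: "\<omega> \<in> space M"
  shows "\<bar>Y t \<omega>\<bar> \<le> U_bound"
proof -
  have "Y t \<omega> \<le> U_bound"
    using cexp_U_bound[OF times_from_measurable _ \<omega>, of _ t "\<lambda>_. t" t]
    by (intro Y_le) (fastforce simp: abs_le_iff)
  then show ?thesis
    using Z_le_Y[OF \<omega>, of t] abs_U_le[OF \<omega>, of t t] by linarith
qed

text \<open>The supremum runs over a possibly uncountable family, but every conditional expectation
  in it is constant on the atoms of \<open>F t\<close>, hence so is the supremum.\<close>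

lemma Y_adapted: "Y t \<in> borel_measurable (F t)"
proof (rule measurable_constant_on_atoms[OF subalgebra_F])
  fix \<omega> \<omega>' assume *: "\<omega> \<in> space M" "\<omega>' \<in> atom (F t) \<omega>"
  have "cexp t f \<omega>' = cexp t f \<omega>" for f
    by (rule at_time.measurable_const_atom[OF borel_measurable_cond_exp *])
  then show "Y t \<omega>' = Y t \<omega>"
    by (simp add: proc_Y_def)
qed simp

text \<open>The only stopping time from \<infinity> on is \<infinity> itself.\<close>

lemma Y_infinity:
  assumes \<omega>: "\<omega> \<in> space M"
  shows "Y \<infinity> \<omega> = U \<infinity> \<infinity> \<omega>"
proof (rule antisym[OF Y_le Z_le_Y[OF \<omega>]])
  fix \<sigma> assume \<sigma>: "\<sigma> \<in> times_from \<infinity>"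
  have U: "integrable M (U \<infinity> \<infinity>)"
    by (rule integrable_bounded[OF U_measurable abs_U_le])
  have "\<sigma> \<omega>' = \<infinity>" if "\<omega>' \<in> space M" for \<omega>'
    using \<sigma> that by (auto simp: stopping_times_ge_def top_unique)
  then have "cexp \<infinity> (\<lambda>\<omega>'. U (\<sigma> \<omega>') \<infinity> \<omega>') \<omega> = cexp \<infinity> (U \<infinity> \<infinity>) \<omega>"
    using U_from_integrable[OF \<sigma>] by (intro at_time.ce_cong U \<omega>) (auto simp: atom_def)
  also have "\<dots> = U \<infinity> \<infinity> \<omega>"
    by (rule at_time.ce_measurable[OF U Z_adapted \<omega>])
  finally show "cexp \<infinity> (\<lambda>\<omega>'. U (\<sigma> \<omega>') \<infinity> \<omega>') \<omega> \<le> U \<infinity> \<infinity> \<omega>"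
    by simp
qed

lemma Y_at_integrable:
  assumes "\<sigma> \<in> borel_measurable M"
  shows "integrable M (\<lambda>\<omega>. Y (\<sigma> \<omega>) \<omega>)"
  by (rule integrable_bounded[OF measurable_at_time[OF measurable_from_F[OF Y_adapted] assms] abs_Y_le])

lemma Y_integrable: "integrable M (Y t)"
  using Y_at_integrable[of "\<lambda>_. t"] by simp

section \<open>Near-optimal reactions by pasting over atoms\<close>

definition atom_rep :: "ennreal \<Rightarrow> 'a \<Rightarrow> 'a" where
  "atom_rep t \<omega> = (SOME \<omega>'. \<omega>' \<in> atom (F t) \<omega>)"

lemma atom_rep:
  assumes "\<omega> \<in> space M"
  shows "atom_rep t \<omega> \<in> atom (F t) \<omega>"
  using someI[of "\<lambda>x. x \<in> atom (F t) \<omega>", OF atom_self[OF assms]] by (simp add: atom_rep_def)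

text \<open>The choice operator sees only the set \<open>atom (F t) \<omega>\<close>, which is the
  same for all points of one atom.\<close>

lemma atom_rep_eq:
  assumes "\<omega> \<in> space M" "\<omega>' \<in> atom (F t) \<omega>"
  shows "atom_rep t \<omega>' = atom_rep t \<omega>"
  by (simp add: atom_rep_def atom_eq[OF subalgebra_F assms])

text \<open>On each atom of \<open>F t\<close> the stopping time selected for its representative is
  followed. For s \<ge> t the atoms are known at time s and there are countably many; for s < t
  nothing has stopped by s, since all pieces are at least t.\<close>

lemma paste_times_from:
  assumes S: "\<And>\<omega>. \<omega> \<in> space M \<Longrightarrow> S \<omega> \<in> times_from t"
  shows "(\<lambda>\<omega>. S (atom_rep t \<omega>) \<omega>) \<in> times_from t"
proof -
  let ?\<beta> = "\<lambda>\<omega>. S (atom_rep t \<omega>) \<omega>"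
  have rep: "atom_rep t \<omega> \<in> space M" if "\<omega> \<in> space M" for \<omega>
    using atom_rep[OF that] by (auto simp: atom_def)
  have ge: "t \<le> ?\<beta> \<omega>" if "\<omega> \<in> space M" for \<omega>
    using S[OF rep[OF that]] that by (simp add: stopping_times_ge_def)
  have "Measurable.pred (F s) (\<lambda>\<omega>. ?\<beta> \<omega> \<le> s)" for s
  proof (cases "t \<le> s")
    case True
    show ?thesis
    proof (rule measurable_compose_countable'[where I = "atom_rep t ` space M"])
      show "Measurable.pred (F s) (\<lambda>\<omega>. S a \<omega> \<le> s)" if "a \<in> atom_rep t ` space M" for a
        using S[of a] that rep
        by (auto simp: stopping_times_ge_def stopping_times_def intro: stopping_timeD)
      have "atom_rep t \<in> measurable (F t) (count_space (atom_rep t ` space M))"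
        by (rule measurable_constant_on_atoms[OF subalgebra_F]) (auto intro: atom_rep_eq)
      moreover have "subalgebra (F s) (F t)"
        using sets_F_mono[OF True] by (simp add: subalgebra_def space_F)
      ultimately show "atom_rep t \<in> measurable (F s) (count_space (atom_rep t ` space M))"
        by (rule measurable_from_subalg[rotated])
      show "countable (atom_rep t ` space M)"
        using countable_space by blast
    qed
  next
    case False
    then have "{\<omega> \<in> space M. ?\<beta> \<omega> \<le> s} = {}"
      using ge by force
    then show ?thesis
      by (simp only: pred_def space_F sets.empty_sets)
  qed
  then show ?thesis
    using ge by (auto simp: stopping_times_ge_def stopping_times_def stopping_time_def)
qed

text \<open>A near-optimal stopping time is chosen separately for every point, and pasting keeps the
  choice made for the representative of each atom. As \<open>Y t\<close> and the conditional
  expectations are constant on atoms, the single pasted time is near-optimal at all points at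
  once.\<close>

lemma Y_near_optimal:
  assumes \<epsilon>: "\<epsilon> > 0"
  shows "\<exists>\<beta>\<in>times_from t. \<forall>\<omega>\<in>space M. Y t \<omega> - \<epsilon> \<le> cexp t (\<lambda>\<omega>'. U (\<beta> \<omega>') t \<omega>') \<omega>"
proof -
  have "\<exists>\<sigma>\<in>times_from t. Y t \<omega> - \<epsilon> < cexp t (\<lambda>\<omega>'. U (\<sigma> \<omega>') t \<omega>') \<omega>" if "\<omega> \<in> space M" for \<omega>
    using \<epsilon> less_cSUP_iff[OF times_from_nonempty[of t] bdd_cexp_U[OF that, of t], of "Y t \<omega> - \<epsilon>"]
    by (simp add: proc_Y_def)
  then obtain S where S: "\<And>\<omega>. \<omega> \<in> space M \<Longrightarrow> S \<omega> \<in> times_from t"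
    "\<And>\<omega>. \<omega> \<in> space M \<Longrightarrow> Y t \<omega> - \<epsilon> < cexp t (\<lambda>\<omega>'. U (S \<omega> \<omega>') t \<omega>') \<omega>"
    by metis
  define \<beta> where "\<beta> \<omega> = S (atom_rep t \<omega>) \<omega>" for \<omega>
  have \<beta>: "\<beta> \<in> times_from t"
    unfolding \<beta>_def by (rule paste_times_from[OF S(1)])
  moreover have "Y t \<omega> - \<epsilon> \<le> cexp t (\<lambda>\<omega>'. U (\<beta> \<omega>') t \<omega>') \<omega>" if \<omega>: "\<omega> \<in> space M" for \<omega>
  proof -
    let ?a = "atom_rep t \<omega>"
    have a: "?a \<in> atom (F t) \<omega>" "?a \<in> space M"
      using atom_rep[OF \<omega>] by (auto simp: atom_def)
    have "Y t \<omega> = Y t ?a"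
      using at_time.measurable_const_atom[OF Y_adapted \<omega> a(1)] by simp
    moreover have "cexp t (\<lambda>\<omega>'. U (\<beta> \<omega>') t \<omega>') \<omega> = cexp t (\<lambda>\<omega>'. U (S ?a \<omega>') t \<omega>') \<omega>"
      using atom_rep_eq[OF \<omega>] U_from_integrable[OF \<beta>] U_from_integrable[OF S(1)[OF a(2)]]
      by (intro at_time.ce_cong \<omega>) (auto simp: \<beta>_def)
    moreover have "cexp t (\<lambda>\<omega>'. U (S ?a \<omega>') t \<omega>') \<omega> = cexp t (\<lambda>\<omega>'. U (S ?a \<omega>') t \<omega>') ?a"
      using at_time.measurable_const_atom[OF borel_measurable_cond_exp \<omega> a(1)] by simp
    ultimately show ?thesis
      using S(2)[OF a(2)] by simp
  qed
  ultimately show ?thesis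
    by blast
qed

section \<open>Exchanging the players\<close>

lemma stopping_game_flip: "stopping_game M F (\<lambda>s t \<omega>. - U t s \<omega>)"
proof (unfold_locales)
  show "\<exists>C. \<forall>s<\<infinity>. \<forall>t<\<infinity>. \<forall>\<omega>\<in>space M. \<bar>- U t s \<omega>\<bar> \<le> C"
    using U_bounded by auto
  show "(\<lambda>\<omega>. - U t s \<omega>) \<in> borel_measurable (F (max s t))" if "s < \<infinity>" "t < \<infinity>" for s t
    using U_adapted[OF that(2,1)] by (simp add: max.commute)
  show "((\<lambda>b. - U b s \<omega>) \<longlongrightarrow> - U \<infinity> s \<omega>) (at \<infinity>)" if "s < \<infinity>" "\<omega> \<in> space M" for s \<omega>
    using U_lim_left[OF that] by (rule tendsto_minus)
  show "((\<lambda>a. - U t a \<omega>) \<longlongrightarrow> - U t \<infinity> \<omega>) (at \<infinity>)" if "t < \<infinity>" "\<omega> \<in> space M" for t \<omega>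
    using U_lim_right[OF that] by (rule tendsto_minus)
  fix \<omega> assume "\<omega> \<in> space M"
  from tendsto_minus[OF U_lim_both[OF this]]
  \<comment> \<open>Exchanging the players exchanges the two coordinates; the product filter is
    symmetric, so the joint limit survives.\<close>
  show "((\<lambda>(a, b). - U b a \<omega>) \<longlongrightarrow> - U \<infinity> \<infinity> \<omega>) (at \<infinity> \<times>\<^sub>F at \<infinity>)"
    by (subst prod_filter_commute)
      (auto simp: filterlim_def filtermap_filtermap case_prod_beta)
qed (rule countable_space full_support; assumption)+

lemma proc_X_flip:
  assumes \<omega>: "\<omega> \<in> space M"
  shows "proc_X M F (\<lambda>s t \<omega>. - U t s \<omega>) t \<omega> = - Y t \<omega>"
proof -
  have "(\<lambda>\<sigma>. cexp t (\<lambda>\<omega>'. - U (\<sigma> \<omega>') t \<omega>') \<omega>) ` times_from t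
      = uminus ` (\<lambda>\<sigma>. cexp t (\<lambda>\<omega>'. U (\<sigma> \<omega>') t \<omega>') \<omega>) ` times_from t"
    by (auto simp: image_image at_time.ce_minus[OF U_from_integrable \<omega>] intro!: image_cong)
  then show ?thesis
    by (simp add: proc_X_def proc_Y_def Inf_real_def image_image)
qed

interpretation flip: stopping_game M F "\<lambda>s t \<omega>. - U t s \<omega>"
  by (rule stopping_game_flip)

lemma proc_Y_flip: "\<omega> \<in> space M \<Longrightarrow> proc_Y M F (\<lambda>s t \<omega>. - U t s \<omega>) t \<omega> = - X t \<omega>"
  using flip.proc_X_flip[of \<omega> t] by simp

lemma X_le_Z: "\<omega> \<in> space M \<Longrightarrow> X t \<omega> \<le> U t t \<omega>"
  using flip.Z_le_Y[of \<omega> t] by (simp add: proc_Y_flip)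

text \<open>The bound is the constant chosen for the flipped payoff, because the estimate is the one
  for its process Y.\<close>

lemma abs_X_le: "\<omega> \<in> space M \<Longrightarrow> \<bar>X t \<omega>\<bar> \<le> flip.U_bound"
  using flip.abs_Y_le[of \<omega> t] by (simp add: proc_Y_flip)

lemma X_adapted: "X t \<in> borel_measurable (F t)"
proof -
  have "(\<lambda>\<omega>. - proc_Y M F (\<lambda>s t \<omega>. - U t s \<omega>) t \<omega>) \<in> borel_measurable (F t)"
    using flip.Y_adapted by simp
  then show ?thesis
    by (rule measurable_cong[THEN iffD1, rotated]) (simp add: space_F proc_Y_flip)
qed

lemma X_at_integrable:
  assumes "\<sigma> \<in> borel_measurable M"
  shows "integrable M (\<lambda>\<omega>. X (\<sigma> \<omega>) \<omega>)"
  by (rule integrable_bounded[OF measurable_at_time[OF measurable_from_F[OF X_adapted] assms] abs_X_le])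

lemma dynkin_payoff_flip:
  "dynkin_payoff M F (\<lambda>s t \<omega>. - U t s \<omega>) \<tau>0 \<rho>0 = - V \<rho>0 \<tau>0"
  unfolding dynkin_payoff_def
  by (subst Bochner_Integration.integral_minus[symmetric], rule Bochner_Integration.integral_cong)
    (auto simp: proc_X_flip proc_Y_flip proc_Z_def)

lemma game_payoff_flip:
  "game_payoff M (\<lambda>s t \<omega>. - U t s \<omega>) \<tau> \<rho> = - game_payoff M U \<rho> \<tau>"
  by (simp add: game_payoff_def)

end

section \<open>From saddle points of the Dynkin game to Nash equilibria\<close>

text \<open>Both the stopping game and the Dynkin game split according to who stops first. Putting
  them in this common form allows them to be compared term by term.\<close>

lemma (in prob_space)
  fixes \<sigma> \<tau> :: "'a \<Rightarrow> ennreal" and a b e :: "'a \<Rightarrow> real"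
  assumes [measurable]: "\<sigma> \<in> borel_measurable M" "\<tau> \<in> borel_measurable M"
    and a: "integrable M a" and b: "integrable M b" and e: "integrable M e"
  shows integrable_trichotomy:
      "integrable M (\<lambda>\<omega>. if \<sigma> \<omega> < \<tau> \<omega> then a \<omega> else if \<tau> \<omega> < \<sigma> \<omega> then b \<omega> else e \<omega>)" (is ?I)
    and integral_trichotomy:
      "(\<integral>\<omega>. (if \<sigma> \<omega> < \<tau> \<omega> then a \<omega> else if \<tau> \<omega> < \<sigma> \<omega> then b \<omega> else e \<omega>) \<partial>M)
      = (\<integral>\<omega>\<in>{\<omega>\<in>space M. \<sigma> \<omega> < \<tau> \<omega>}. a \<omega> \<partial>M) + (\<integral>\<omega>\<in>{\<omega>\<in>space M. \<tau> \<omega> < \<sigma> \<omega>}. b \<omega> \<partial>M)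
        + (\<integral>\<omega>\<in>{\<omega>\<in>space M. \<sigma> \<omega> = \<tau> \<omega>}. e \<omega> \<partial>M)" (is "?l = ?r")
proof -
  let ?A = "{\<omega>\<in>space M. \<sigma> \<omega> < \<tau> \<omega>}" and ?B = "{\<omega>\<in>space M. \<tau> \<omega> < \<sigma> \<omega>}"
    and ?E = "{\<omega>\<in>space M. \<sigma> \<omega> = \<tau> \<omega>}"
  have i: "integrable M (\<lambda>\<omega>. indicator ?A \<omega> *\<^sub>R a \<omega>)" "integrable M (\<lambda>\<omega>. indicator ?B \<omega> *\<^sub>R b \<omega>)"
    "integrable M (\<lambda>\<omega>. indicator ?E \<omega> *\<^sub>R e \<omega>)"
    by (intro integrable_mult_indicator a b e; measurable)+
  have eq: "(if \<sigma> \<omega> < \<tau> \<omega> then a \<omega> else if \<tau> \<omega> < \<sigma> \<omega> then b \<omega> else e \<omega>)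
      = (indicator ?A \<omega> *\<^sub>R a \<omega> + indicator ?B \<omega> *\<^sub>R b \<omega>) + indicator ?E \<omega> *\<^sub>R e \<omega>"
    if "\<omega> \<in> space M" for \<omega>
    using that by (auto simp: indicator_def)
  show ?I
    by (subst Bochner_Integration.integrable_cong[OF refl eq], assumption)
      (intro Bochner_Integration.integrable_add i)
  show "?l = ?r"
    unfolding set_lebesgue_integral_def
    by (subst Bochner_Integration.integral_cong[OF refl eq], assumption)
      (simp only: Bochner_Integration.integral_add Bochner_Integration.integrable_add i)
qed

lemma (in prob_space) set_integrable_of_integrable:
  fixes f :: "'a \<Rightarrow> real"
  assumes "integrable M f" "A \<in> sets M"
  shows "set_integrable M A f"
  using integrable_mult_indicator[OF assms(2,1)] by (simp add: set_integrable_def)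

context stopping_game
begin

lemma stopping_map_measurable:
  assumes "\<phi> \<in> stopping_maps M F"
  shows "\<phi> t \<in> borel_measurable M"
proof -
  have "(\<lambda>\<omega>. (t, \<omega>)) \<in> measurable M (borel \<Otimes>\<^sub>M M)"
    by measurable
  from measurable_compose[OF this, of "\<lambda>(t, \<omega>). \<phi> t \<omega>" borel] assms show ?thesis
    by (auto simp: stopping_maps_def)
qed

lemma stopping_map_times_from:
  "\<phi> \<in> stopping_maps M F \<Longrightarrow> t < \<infinity> \<Longrightarrow> \<phi> t \<in> times_from t"
  by (auto simp: stopping_maps_def stopping_times_gt_def stopping_times_ge_def less_imp_le)

text \<open>If \<rho> stops first, the reaction \<open>\<tau>1\<close> concedes at most X + c; if
  \<tau> stops first, any reaction of \<rho> is a stopping time from \<open>\<tau>0\<close> on and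
  so yields at most Y; simultaneous stopping yields Z in both games. On the first two events the
  earlier time is finite, which is why \<open>le\<close> is assumed for finite t only. The error c
  is weighted by the probability of the first event and hence counts at most once.\<close>

lemma game_payoff_le:
  assumes \<rho>: "\<rho> \<in> strategies M F" and \<tau>0: "stopping_time F \<tau>0" and \<tau>1: "\<tau>1 \<in> stopping_maps M F"
    and c: "0 \<le> c"
    and le: "\<And>t \<omega>. t < \<infinity> \<Longrightarrow> \<omega> \<in> space M \<Longrightarrow> cexp t (\<lambda>\<omega>'. U t (\<tau>1 t \<omega>') \<omega>') \<omega> \<le> X t \<omega> + c"
  shows "game_payoff M U \<rho> (\<tau>0, \<tau>1) \<le> V (fst \<rho>) \<tau>0 + c"
proof -
  obtain \<rho>0 \<rho>1 where \<rho>_eq: "\<rho> = (\<rho>0, \<rho>1)" and \<rho>0: "stopping_time F \<rho>0" and \<rho>1: "\<rho>1 \<in> stopping_maps M F"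
    using \<rho> by (auto simp: strategies_def stopping_times_def)
  note [measurable] = stopping_time_measurable[OF \<rho>0] stopping_time_measurable[OF \<tau>0]
  have m: "(\<lambda>\<omega>. \<phi> (\<sigma> \<omega>) \<omega>) \<in> borel_measurable M"
    if "\<phi> \<in> stopping_maps M F" "\<sigma> \<in> borel_measurable M" for \<phi> \<sigma>
    by (rule measurable_at_time[OF stopping_map_measurable[OF that(1)] that(2)])
  let ?a = "\<lambda>\<omega>. U (\<rho>0 \<omega>) (\<tau>1 (\<rho>0 \<omega>) \<omega>) \<omega>" and ?b = "\<lambda>\<omega>. U (\<rho>1 (\<tau>0 \<omega>) \<omega>) (\<tau>0 \<omega>) \<omega>"
    and ?e = "\<lambda>\<omega>. U (\<rho>0 \<omega>) (\<rho>0 \<omega>) \<omega>"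
  let ?A = "{\<omega>\<in>space M. \<rho>0 \<omega> < \<tau>0 \<omega>}" and ?B = "{\<omega>\<in>space M. \<tau>0 \<omega> < \<rho>0 \<omega>}"
    and ?E = "{\<omega>\<in>space M. \<rho>0 \<omega> = \<tau>0 \<omega>}"
  have int: "integrable M ?a" "integrable M ?b" "integrable M ?e"
    "integrable M (\<lambda>\<omega>. X (\<rho>0 \<omega>) \<omega>)" "integrable M (\<lambda>\<omega>. Y (\<tau>0 \<omega>) \<omega>)"
    by (rule U_at_integrable X_at_integrable Y_at_integrable,
        (rule m[OF \<tau>1] m[OF \<rho>1] stopping_time_measurable[OF \<rho>0] stopping_time_measurable[OF \<tau>0])+)+
  have A: "?A \<in> sets (pre_sigma \<rho>0)" and B: "?B \<in> sets (pre_sigma \<tau>0)"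
    using stopping_time_less[OF \<rho>0 \<tau>0] stopping_time_less[OF \<tau>0 \<rho>0]
    by (simp_all add: pred_def space_pre_sigma)
  have "(\<integral>\<omega>\<in>?A. ?a \<omega> \<partial>M) \<le> (\<integral>\<omega>\<in>?A. X (\<rho>0 \<omega>) \<omega> + c \<partial>M)"
  proof (rule set_integral_at_stopping_time_mono[where f = "\<lambda>t \<omega>. U t (\<tau>1 t \<omega>) \<omega>"
        and g = "\<lambda>t \<omega>. X t \<omega> + c", OF \<rho>0 A])
    show "integrable M (\<lambda>\<omega>. U t (\<tau>1 t \<omega>) \<omega>)" for t
      by (rule U_at_integrable[OF borel_measurable_const stopping_map_measurable[OF \<tau>1]])
    show "integrable M (\<lambda>\<omega>. X (\<rho>0 \<omega>) \<omega> + c)"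
      using int(4) by simp
    show "cexp (\<rho>0 \<omega>) (\<lambda>\<omega>'. U (\<rho>0 \<omega>) (\<tau>1 (\<rho>0 \<omega>) \<omega>') \<omega>') \<omega> \<le> X (\<rho>0 \<omega>) \<omega> + c" if "\<omega> \<in> ?A" for \<omega>
      using that by (intro le) (auto intro: less_le_trans)
  qed (rule int)
  also have "\<dots> \<le> (\<integral>\<omega>\<in>?A. X (\<rho>0 \<omega>) \<omega> \<partial>M) + c"
  proof -
    have "(\<integral>\<omega>\<in>?A. X (\<rho>0 \<omega>) \<omega> + c \<partial>M) = (\<integral>\<omega>\<in>?A. X (\<rho>0 \<omega>) \<omega> \<partial>M) + (\<integral>\<omega>\<in>?A. c \<partial>M)"
      by (intro set_integral_add(2) set_integrable_of_integrable int integrable_const) measurable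
    also have "(\<integral>\<omega>\<in>?A. c \<partial>M) = c * prob ?A"
      by (subst set_integral_const) auto
    also have "\<dots> \<le> c"
      using c by (simp add: mult_left_le)
    finally show ?thesis by simp
  qed
  moreover have "(\<integral>\<omega>\<in>?B. ?b \<omega> \<partial>M) \<le> (\<integral>\<omega>\<in>?B. Y (\<tau>0 \<omega>) \<omega> \<partial>M)"
  proof (rule set_integral_at_stopping_time_mono[where f = "\<lambda>t \<omega>. U (\<rho>1 t \<omega>) t \<omega>" and g = Y, OF \<tau>0 B])
    show "integrable M (\<lambda>\<omega>. U (\<rho>1 t \<omega>) t \<omega>)" for t
      by (rule U_at_integrable[OF stopping_map_measurable[OF \<rho>1] borel_measurable_const])
    show "cexp (\<tau>0 \<omega>) (\<lambda>\<omega>'. U (\<rho>1 (\<tau>0 \<omega>) \<omega>') (\<tau>0 \<omega>) \<omega>') \<omega> \<le> Y (\<tau>0 \<omega>) \<omega>" if "\<omega> \<in> ?B" for \<omega>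
      using that by (intro cexp_le_Y stopping_map_times_from \<rho>1) (auto intro: less_le_trans)
  qed (rule int)+
  moreover have "game_payoff M U \<rho> (\<tau>0, \<tau>1)
      = (\<integral>\<omega>\<in>?A. ?a \<omega> \<partial>M) + (\<integral>\<omega>\<in>?B. ?b \<omega> \<partial>M) + (\<integral>\<omega>\<in>?E. ?e \<omega> \<partial>M)"
    unfolding game_payoff_def \<rho>_eq
    by (subst integral_trichotomy[symmetric, OF _ _ int(1-3)], measurable)
      (auto intro!: Bochner_Integration.integral_cong simp: outcome_def)
  moreover have "V (fst \<rho>) \<tau>0 = (\<integral>\<omega>\<in>?A. X (\<rho>0 \<omega>) \<omega> \<partial>M) + (\<integral>\<omega>\<in>?B. Y (\<tau>0 \<omega>) \<omega> \<partial>M) + (\<integral>\<omega>\<in>?E. ?e \<omega> \<partial>M)"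
    unfolding dynkin_payoff_def \<rho>_eq proc_Z_def fst_conv
    by (rule integral_trichotomy[OF _ _ int(4,5,3)]) measurable
  ultimately show ?thesis
    by linarith
qed

lemma game_payoff_ge:
  assumes \<tau>: "\<tau> \<in> strategies M F" and \<rho>0: "stopping_time F \<rho>0" and \<rho>1: "\<rho>1 \<in> stopping_maps M F"
    and c: "0 \<le> c"
    and le: "\<And>t \<omega>. t < \<infinity> \<Longrightarrow> \<omega> \<in> space M \<Longrightarrow> Y t \<omega> - c \<le> cexp t (\<lambda>\<omega>'. U (\<rho>1 t \<omega>') t \<omega>') \<omega>"
  shows "V \<rho>0 (fst \<tau>) - c \<le> game_payoff M U (\<rho>0, \<rho>1) \<tau>"
proof -
  interpret flip: stopping_game M F "\<lambda>s t \<omega>. - U t s \<omega>"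
    by (rule stopping_game_flip)
  have "cexp t (\<lambda>\<omega>'. - U (\<rho>1 t \<omega>') t \<omega>') \<omega> \<le> proc_X M F (\<lambda>s t \<omega>. - U t s \<omega>) t \<omega> + c"
    if "t < \<infinity>" "\<omega> \<in> space M" for t \<omega>
    using le[OF that]
    by (simp add: proc_X_flip[OF that(2)]
        at_time.ce_minus[OF U_at_integrable[OF stopping_map_measurable[OF \<rho>1] borel_measurable_const] that(2)])
  from flip.game_payoff_le[OF \<tau> \<rho>0 \<rho>1 c this] show ?thesis
    by (simp add: game_payoff_flip dynkin_payoff_flip)
qed

text \<open>A deviation \<rho> earns at most \<open>V (fst \<rho>) \<tau>0 + c\<close>, this is
  below \<open>V \<rho>0 \<tau>0 + \<epsilon> + c\<close>, and the candidate pair itself earns at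
  least \<open>V \<rho>0 \<tau>0 - c\<close>. The other player is treated symmetrically.\<close>

lemma nash_equilibrium_of_saddle_point:
  assumes saddle: "dynkin_saddle_point M F U \<epsilon> \<rho>0 \<tau>0"
    and \<rho>1: "\<rho>1 \<in> stopping_maps M F" and \<tau>1: "\<tau>1 \<in> stopping_maps M F" and c: "0 \<le> c"
    and X: "\<And>t \<omega>. t < \<infinity> \<Longrightarrow> \<omega> \<in> space M \<Longrightarrow> cexp t (\<lambda>\<omega>'. U t (\<tau>1 t \<omega>') \<omega>') \<omega> \<le> X t \<omega> + c"
    and Y: "\<And>t \<omega>. t < \<infinity> \<Longrightarrow> \<omega> \<in> space M \<Longrightarrow> Y t \<omega> - c \<le> cexp t (\<lambda>\<omega>'. U (\<rho>1 t \<omega>') t \<omega>') \<omega>"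
  shows "nash_equilibrium M F U (\<lambda>s t \<omega>. - U s t \<omega>) (\<epsilon> + 2 * c) (\<rho>0, \<rho>1) (\<tau>0, \<tau>1)"
proof -
  have \<rho>0: "stopping_time F \<rho>0" and \<tau>0: "stopping_time F \<tau>0"
    and sp: "\<And>\<sigma>. stopping_time F \<sigma> \<Longrightarrow> V \<sigma> \<tau>0 - \<epsilon> < V \<rho>0 \<tau>0"
      "\<And>\<sigma>. stopping_time F \<sigma> \<Longrightarrow> V \<rho>0 \<tau>0 < V \<rho>0 \<sigma> + \<epsilon>"
    using saddle by (auto simp: dynkin_saddle_point_def stopping_times_def)
  have strat: "(\<rho>0, \<rho>1) \<in> strategies M F" "(\<tau>0, \<tau>1) \<in> strategies M F"
    using \<rho>0 \<tau>0 \<rho>1 \<tau>1 by (auto simp: strategies_def stopping_times_def)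
  have st: "stopping_time F (fst \<sigma>)" if "\<sigma> \<in> strategies M F" for \<sigma>
    using that by (auto simp: strategies_def stopping_times_def)
  have lower: "V \<rho>0 \<tau>0 - c \<le> game_payoff M U (\<rho>0, \<rho>1) (\<tau>0, \<tau>1)"
    using game_payoff_ge[OF strat(2) \<rho>0 \<rho>1 c Y] by simp
  have upper: "game_payoff M U (\<rho>0, \<rho>1) (\<tau>0, \<tau>1) \<le> V \<rho>0 \<tau>0 + c"
    using game_payoff_le[OF strat(1) \<tau>0 \<tau>1 c X] by simp
  have "game_payoff M U \<rho> (\<tau>0, \<tau>1) \<le> game_payoff M U (\<rho>0, \<rho>1) (\<tau>0, \<tau>1) + (\<epsilon> + 2 * c)"
    if "\<rho> \<in> strategies M F" for \<rho>
    using game_payoff_le[OF that \<tau>0 \<tau>1 c X] sp(1)[OF st[OF that]] lower by simp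
  moreover have "game_payoff M (\<lambda>s t \<omega>. - U s t \<omega>) (\<rho>0, \<rho>1) \<tau>
      \<le> game_payoff M (\<lambda>s t \<omega>. - U s t \<omega>) (\<rho>0, \<rho>1) (\<tau>0, \<tau>1) + (\<epsilon> + 2 * c)"
    if "\<tau> \<in> strategies M F" for \<tau>
    using game_payoff_ge[OF that \<rho>0 \<rho>1 c Y] sp(2)[OF st[OF that]] upper
    by (simp add: game_payoff_def)
  ultimately show ?thesis
    using strat by (auto simp: nash_equilibrium_def)
qed

section \<open>Reaction maps built on a time grid\<close>

lemma grid_index:
  assumes h: "h > 0" and t: "t < \<infinity>"
  shows "t < ennreal (real (nat \<lfloor>enn2real t / h\<rfloor> + 1) * h)"
    and "ennreal (real (nat \<lfloor>enn2real t / h\<rfloor> + 1) * h) \<le> t + ennreal h"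
proof -
  obtain x where x: "t = ennreal x" "x \<ge> 0"
    using t by (cases t) auto
  define n where "n = nat \<lfloor>x / h\<rfloor>"
  have n: "real n = of_int \<lfloor>x / h\<rfloor>"
    using x(2) h by (simp add: n_def)
  have "x / h < real n + 1" "real n \<le> x / h"
    unfolding n by linarith+
  then have "x < (real n + 1) * h" "(real n + 1) * h \<le> x + h"
    using h by (auto simp: field_simps)
  then show "t < ennreal (real (nat \<lfloor>enn2real t / h\<rfloor> + 1) * h)"
    "ennreal (real (nat \<lfloor>enn2real t / h\<rfloor> + 1) * h) \<le> t + ennreal h"
    using x h by (auto simp: n_def[symmetric] ennreal_less_iff simp flip: ennreal_plus intro!: ennreal_leI)
      (simp_all add: add.commute)
qed

text \<open>The index in \<open>grid_map\<close> is the integer part plus one, so the reaction comes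
  no earlier than a grid time strictly after t. This gives the strict inequality demanded of a
  stopping map even when t lies on the grid.\<close>

lemma grid_map_stopping_map:
  assumes h: "h > 0" and \<beta>: "\<And>n. \<beta> n \<in> times_from (ennreal (real n * h))"
  shows "grid_map h \<beta> \<in> stopping_maps M F"
proof -
  have [measurable]: "\<beta> n \<in> borel_measurable M" for n
    using times_from_measurable[OF \<beta>] .
  have "(\<lambda>x. if fst x = \<infinity> then \<infinity> else \<beta> (nat \<lfloor>enn2real (fst x) / h\<rfloor> + 1) (snd x))
      \<in> borel_measurable (borel \<Otimes>\<^sub>M M)"
    by measurable
  moreover have "grid_map h \<beta> t \<in> stopping_times_gt M F (\<lambda>_. t)" if t: "t < \<infinity>" for t
  proof -
    have "grid_map h \<beta> t = \<beta> (nat \<lfloor>enn2real t / h\<rfloor> + 1)"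
      using t by (auto simp: grid_map_def)
    then show ?thesis
      using \<beta>[of "nat \<lfloor>enn2real t / h\<rfloor> + 1"] grid_index(1)[OF h t]
      by (auto simp: stopping_times_gt_def stopping_times_ge_def intro: less_le_trans)
  qed
  ultimately show ?thesis
    by (simp add: stopping_maps_def grid_map_def case_prod_beta')
qed

lemma near_maximizers_exist:
  assumes "\<epsilon> > 0"
  shows "\<exists>\<beta>. near_maximizers M F U \<epsilon> h \<beta>"
proof -
  have "\<forall>t. \<exists>\<beta>. \<beta> \<in> times_from t \<and>
      (\<forall>\<omega>\<in>space M. Y t \<omega> - \<epsilon> \<le> cexp t (\<lambda>\<omega>'. U (\<beta> \<omega>') t \<omega>') \<omega>)"
    using Y_near_optimal[OF assms] by blast
  from choice[OF this] obtain \<beta> where "\<forall>t. \<beta> t \<in> times_from t \<and>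
      (\<forall>\<omega>\<in>space M. Y t \<omega> - \<epsilon> \<le> cexp t (\<lambda>\<omega>'. U (\<beta> t \<omega>') t \<omega>') \<omega>)" ..
  then have "near_maximizers M F U \<epsilon> h (\<lambda>n. \<beta> (ennreal (real n * h)))"
    by (simp add: near_maximizers_def Let_def)
  then show ?thesis
    by blast
qed

end

section \<open>Consequences of the modulus of continuity\<close>

lemma time_dist_self: "time_dist t t = 0"
  by (simp add: time_dist_def)

text \<open>An infinite \<sigma> is covered: the maximum does not move it, and the distance from
  \<infinity> to itself is 0.\<close>

lemma time_dist_max_le:
  assumes "s \<le> \<sigma>" "t \<le> s + \<delta>"
  shows "time_dist \<sigma> (max \<sigma> t) \<le> \<delta>"
proof (cases "t \<le> \<sigma>")
  case True
  then show ?thesis by (simp add: max_absorb1 time_dist_self)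
next
  case False
  then have "time_dist \<sigma> (max \<sigma> t) = t - \<sigma>"
    by (simp add: time_dist_def max_def min_def)
  also have "\<dots> \<le> \<delta>"
    using assms False by (metis add_right_mono ennreal_minus_le_iff leI order_trans less_imp_le top.extremum_strict)
  finally show ?thesis .
qed

locale uniform_stopping_game = stopping_game M F U
  for M :: "'a measure" and F :: "ennreal \<Rightarrow> 'a measure"
    and U :: "ennreal \<Rightarrow> ennreal \<Rightarrow> 'a \<Rightarrow> real" +
  fixes r :: "ennreal \<Rightarrow> real"
  assumes r_mono: "mono r"
    and r_lim: "(r \<longlongrightarrow> 0) (at_right 0)"
    and r_zero: "r 0 = 0"
    and U_modulus: "\<And>s t s' t' \<omega>. \<omega> \<in> space M \<Longrightarrow>
      \<bar>U s t \<omega> - U s' t' \<omega>\<bar> \<le> r (time_dist s s' + time_dist t t')"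
begin

lemma r_nonneg: "0 \<le> r x"
  using monoD[OF r_mono, of 0 x] r_zero by simp

lemma uniform_stopping_game_flip: "uniform_stopping_game M F (\<lambda>s t \<omega>. - U t s \<omega>) r"
proof -
  interpret flip: stopping_game M F "\<lambda>s t \<omega>. - U t s \<omega>"
    by (rule stopping_game_flip)
  have "\<bar>- U t s \<omega> - - U t' s' \<omega>\<bar> \<le> r (time_dist s s' + time_dist t t')" if "\<omega> \<in> space M" for s t s' t' \<omega>
    using U_modulus[OF that, of t s t' s'] by (simp add: add.commute abs_minus_commute)
  then show ?thesis
    by unfold_locales (auto intro: r_mono r_lim r_zero)
qed

text \<open>A reaction that is nearly optimal at t is also admissible at s. By the tower property
  only the second argument of U changes, from t to s, at a cost of at most
  \<open>r \<delta>\<close>.\<close>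

lemma cexp_Y_le:
  assumes "s \<le> t" "t \<le> s + \<delta>" "\<omega> \<in> space M"
  shows "cexp s (Y t) \<omega> \<le> Y s \<omega> + r \<delta>"
proof (rule field_le_epsilon)
  fix \<epsilon> :: real assume "\<epsilon> > 0"
  from Y_near_optimal[OF this] obtain \<beta> where \<beta>: "\<beta> \<in> times_from t"
    "\<And>\<omega>. \<omega> \<in> space M \<Longrightarrow> Y t \<omega> - \<epsilon> \<le> cexp t (\<lambda>\<omega>'. U (\<beta> \<omega>') t \<omega>') \<omega>"
    by blast
  have int: "integrable M (\<lambda>\<omega>'. U (\<beta> \<omega>') s' \<omega>')" for s'
    by (rule U_from_integrable[OF \<beta>(1)])
  have at: "\<omega>' \<in> space M" if "\<omega>' \<in> atom (F s) \<omega>" for \<omega>'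
    using that by (simp add: atom_def)
  have "cexp s (Y t) \<omega> \<le> cexp s (\<lambda>\<omega>'. cexp t (\<lambda>\<omega>'. U (\<beta> \<omega>') t \<omega>') \<omega>' + \<epsilon>) \<omega>"
    using \<beta>(2)[OF at] at_time.real_cond_exp_int(1)[OF int]
    by (intro at_time.ce_mono Y_integrable assms) (auto simp: algebra_simps)
  also have "\<dots> = cexp s (cexp t (\<lambda>\<omega>'. U (\<beta> \<omega>') t \<omega>')) \<omega> + \<epsilon>"
    by (rule at_time.ce_add_const[OF at_time.real_cond_exp_int(1)[OF int] assms(3)])
  also have "cexp s (cexp t (\<lambda>\<omega>'. U (\<beta> \<omega>') t \<omega>')) \<omega> = cexp s (\<lambda>\<omega>'. U (\<beta> \<omega>') t \<omega>') \<omega>"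
    by (rule at_time.ce_tower[OF subalgebra_F sets_F_mono[OF assms(1)] int assms(3)])
  also have "\<dots> \<le> cexp s (\<lambda>\<omega>'. U (\<beta> \<omega>') s \<omega>' + r \<delta>) \<omega>"
  proof (intro at_time.ce_mono assms(3) int Bochner_Integration.integrable_add integrable_const)
    fix \<omega>' assume "\<omega>' \<in> atom (F s) \<omega>"
    from U_modulus[OF at[OF this], of "\<beta> \<omega>'" t "\<beta> \<omega>'" s]
    have "U (\<beta> \<omega>') t \<omega>' \<le> U (\<beta> \<omega>') s \<omega>' + r (time_dist t s)"
      by (simp add: time_dist_self abs_le_iff)
    also have "time_dist t s = time_dist s (max s t)"
      using assms(1) by (auto simp: time_dist_def max_def min_def)
    also have "r \<dots> \<le> r \<delta>"
      by (intro monoD[OF r_mono] time_dist_max_le[OF order_refl assms(2)])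
    finally show "U (\<beta> \<omega>') t \<omega>' \<le> U (\<beta> \<omega>') s \<omega>' + r \<delta>"
      by simp
  qed
  also have "\<dots> = cexp s (\<lambda>\<omega>'. U (\<beta> \<omega>') s \<omega>') \<omega> + r \<delta>"
    by (rule at_time.ce_add_const[OF int assms(3)])
  also have "cexp s (\<lambda>\<omega>'. U (\<beta> \<omega>') s \<omega>') \<omega> \<le> Y s \<omega>"
    using \<beta>(1) times_from_mono[OF assms(1)] by (intro cexp_le_Y assms(3)) auto
  finally show "cexp s (Y t) \<omega> \<le> Y s \<omega> + r \<delta> + \<epsilon>"
    by simp
qed

text \<open>A reaction \<sigma> to a stop at s is delayed to max \<sigma> t, which is admissible at
  t. Now both arguments of U move, each by at most \<delta>, hence the error
  \<open>r (\<delta> + \<delta>)\<close>.\<close>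

lemma Y_le_cexp:
  assumes "s \<le> t" "t \<le> s + \<delta>" and \<omega>: "\<omega> \<in> space M"
  shows "Y s \<omega> \<le> cexp s (Y t) \<omega> + r (\<delta> + \<delta>)"
proof (rule Y_le)
  fix \<sigma> assume \<sigma>: "\<sigma> \<in> times_from s"
  define \<sigma>' where "\<sigma>' \<omega> = max (\<sigma> \<omega>) t" for \<omega>
  have \<sigma>': "\<sigma>' \<in> times_from t"
    using \<sigma> by (auto simp: \<sigma>'_def[abs_def] stopping_times_ge_def stopping_times_def
        intro: stopping_time_max stopping_time_const)
  note int = U_from_integrable[OF \<sigma>] U_from_integrable[OF \<sigma>']
  have at: "\<omega>' \<in> space M" if "\<omega>' \<in> atom (F s) \<omega>" for \<omega>'
    using that by (simp add: atom_def)
  have "cexp s (\<lambda>\<omega>'. U (\<sigma> \<omega>') s \<omega>') \<omega> \<le> cexp s (\<lambda>\<omega>'. U (\<sigma>' \<omega>') t \<omega>' + r (\<delta> + \<delta>)) \<omega>"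
  proof (intro at_time.ce_mono \<omega> int Bochner_Integration.integrable_add integrable_const)
    fix \<omega>' assume "\<omega>' \<in> atom (F s) \<omega>"
    note \<omega>' = at[OF this]
    have "time_dist (\<sigma> \<omega>') (\<sigma>' \<omega>') \<le> \<delta>"
      unfolding \<sigma>'_def using \<sigma> \<omega>' by (intro time_dist_max_le[where s = s] assms(2)) (simp add: stopping_times_ge_def)
    moreover have "time_dist s t \<le> \<delta>"
      using time_dist_max_le[OF order_refl assms(2)] assms(1) by (simp add: max_absorb2)
    ultimately have "r (time_dist (\<sigma> \<omega>') (\<sigma>' \<omega>') + time_dist s t) \<le> r (\<delta> + \<delta>)"
      by (intro monoD[OF r_mono] add_mono)
    then show "U (\<sigma> \<omega>') s \<omega>' \<le> U (\<sigma>' \<omega>') t \<omega>' + r (\<delta> + \<delta>)"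
      using U_modulus[OF \<omega>', of "\<sigma> \<omega>'" s "\<sigma>' \<omega>'" t] by (simp add: abs_le_iff)
  qed
  also have "\<dots> = cexp s (\<lambda>\<omega>'. U (\<sigma>' \<omega>') t \<omega>') \<omega> + r (\<delta> + \<delta>)"
    by (rule at_time.ce_add_const[OF int(2) \<omega>])
  also have "cexp s (\<lambda>\<omega>'. U (\<sigma>' \<omega>') t \<omega>') \<omega> = cexp s (cexp t (\<lambda>\<omega>'. U (\<sigma>' \<omega>') t \<omega>')) \<omega>"
    by (rule at_time.ce_tower[symmetric, OF subalgebra_F sets_F_mono[OF assms(1)] int(2) \<omega>])
  also have "\<dots> \<le> cexp s (Y t) \<omega>"
    using at_time.real_cond_exp_int(1)[OF int(2)]
    by (intro at_time.ce_mono Y_integrable \<omega> cexp_le_Y \<sigma>' at)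
  finally show "cexp s (\<lambda>\<omega>'. U (\<sigma> \<omega>') s \<omega>') \<omega> \<le> cexp s (Y t) \<omega> + r (\<delta> + \<delta>)"
    by simp
qed

text \<open>With s the next grid time after t, passing from Y at t to Y at s costs
  \<open>r (h + h)\<close>, near-optimality of the grid reaction at s costs \<epsilon>, and
  replacing s by t as the opponent's time costs \<open>r h\<close>.\<close>

lemma grid_map_near_optimal:
  assumes h: "h > 0" and \<beta>: "near_maximizers M F U \<epsilon> h \<beta>" and t: "t < \<infinity>" and \<omega>: "\<omega> \<in> space M"
  shows "Y t \<omega> - (\<epsilon> + r (ennreal h) + r (ennreal h + ennreal h))
    \<le> cexp t (\<lambda>\<omega>'. U (grid_map h \<beta> t \<omega>') t \<omega>') \<omega>"
proof -
  define n where "n = nat \<lfloor>enn2real t / h\<rfloor> + 1"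
  define s where "s = ennreal (real n * h)"
  have ts: "t \<le> s" "s \<le> t + ennreal h"
    using grid_index[OF h t] by (simp_all add: n_def s_def)
  have grid: "grid_map h \<beta> t = \<beta> n"
    using t by (auto simp: grid_map_def n_def)
  have \<beta>n: "\<beta> n \<in> times_from s"
    "\<And>\<omega>. \<omega> \<in> space M \<Longrightarrow> Y s \<omega> - \<epsilon> \<le> cexp s (\<lambda>\<omega>'. U (\<beta> n \<omega>') s \<omega>') \<omega>"
    using \<beta> by (simp_all add: near_maximizers_def Let_def s_def)
  have int: "integrable M (\<lambda>\<omega>'. U (\<beta> n \<omega>') s' \<omega>')" for s'
    by (rule U_from_integrable[OF \<beta>n(1)])
  have at: "\<omega>' \<in> space M" if "\<omega>' \<in> atom (F t) \<omega>" for \<omega>'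
    using that by (simp add: atom_def)
  have "Y t \<omega> \<le> cexp t (Y s) \<omega> + r (ennreal h + ennreal h)"
    by (rule Y_le_cexp[OF ts \<omega>])
  also have "cexp t (Y s) \<omega> \<le> cexp t (\<lambda>\<omega>'. cexp s (\<lambda>\<omega>'. U (\<beta> n \<omega>') s \<omega>') \<omega>' + \<epsilon>) \<omega>"
    using \<beta>n(2)[OF at] at_time.real_cond_exp_int(1)[OF int]
    by (intro at_time.ce_mono Y_integrable \<omega>) (auto simp: algebra_simps)
  also have "\<dots> = cexp t (cexp s (\<lambda>\<omega>'. U (\<beta> n \<omega>') s \<omega>')) \<omega> + \<epsilon>"
    by (rule at_time.ce_add_const[OF at_time.real_cond_exp_int(1)[OF int] \<omega>])
  also have "cexp t (cexp s (\<lambda>\<omega>'. U (\<beta> n \<omega>') s \<omega>')) \<omega> = cexp t (\<lambda>\<omega>'. U (\<beta> n \<omega>') s \<omega>') \<omega>"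
    by (rule at_time.ce_tower[OF subalgebra_F sets_F_mono[OF ts(1)] int \<omega>])
  also have "\<dots> \<le> cexp t (\<lambda>\<omega>'. U (\<beta> n \<omega>') t \<omega>' + r (ennreal h)) \<omega>"
  proof (intro at_time.ce_mono \<omega> int Bochner_Integration.integrable_add integrable_const)
    fix \<omega>' assume "\<omega>' \<in> atom (F t) \<omega>"
    from U_modulus[OF at[OF this], of "\<beta> n \<omega>'" t "\<beta> n \<omega>'" s]
    have "U (\<beta> n \<omega>') s \<omega>' \<le> U (\<beta> n \<omega>') t \<omega>' + r (time_dist t s)"
      by (simp add: time_dist_self abs_le_iff)
    also have "r (time_dist t s) \<le> r (ennreal h)"
      using time_dist_max_le[OF order_refl ts(2)] ts(1) by (intro monoD[OF r_mono]) (simp add: max_absorb2)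
    finally show "U (\<beta> n \<omega>') s \<omega>' \<le> U (\<beta> n \<omega>') t \<omega>' + r (ennreal h)"
      by simp
  qed
  also have "\<dots> = cexp t (\<lambda>\<omega>'. U (\<beta> n \<omega>') t \<omega>') \<omega> + r (ennreal h)"
    by (rule at_time.ce_add_const[OF int \<omega>])
  finally show ?thesis
    by (simp add: grid)
qed

lemma small_mesh:
  assumes "\<delta> > 0"
  shows "\<exists>h>0. r (ennreal h) + r (ennreal h + ennreal h) < \<delta>"
proof -
  have "eventually (\<lambda>x. r x < \<delta> / 2) (at_right 0)"
    using assms by (intro order_tendstoD(2)[OF r_lim]) auto
  then obtain b where b: "b > 0" "\<And>x. 0 < x \<Longrightarrow> x < b \<Longrightarrow> r x < \<delta> / 2"
    unfolding eventually_at_right[OF zero_less_one] by blast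
  obtain y where y: "0 < ennreal y" "ennreal y < b" "y > 0"
    using dense[OF b(1)] by (metis b(1) ennreal_cases ennreal_less_zero_iff less_top_ennreal not_less_iff_gr_or_eq order_less_trans top.not_eq_extremum)
  \<comment> \<open>Both h and 2 * h have to stay below y.\<close>
  define h where "h = y / 3"
  have h: "h > 0" "h < y" "h + h < y"
    using y by (auto simp: h_def)
  have "r (ennreal h) < \<delta> / 2"
    using h y by (intro b(2)) (auto intro: order.strict_trans[OF _ y(2)] simp: ennreal_less_iff)
  moreover have "r (ennreal h + ennreal h) < \<delta> / 2"
    using h y by (intro b(2)) (auto intro: order.strict_trans[OF _ y(2)] simp: ennreal_less_iff simp flip: ennreal_plus)
  ultimately show ?thesis
    using h(1) by (intro exI[of _ h]) auto
qed

end

section \<open>Discretising the Dynkin game\<close>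

text \<open>Optional stopping at a bounded index: passing from min n m to min (n + 1) m adds the
  increment of W on {n < m} only, so the integrated inequality is needed on that event
  alone.\<close>

lemma (in prob_space) integral_le_stopped:
  fixes m :: "'a \<Rightarrow> nat" and W :: "nat \<Rightarrow> 'a \<Rightarrow> real"
  assumes m: "\<And>n. {\<omega>\<in>space M. n < m \<omega>} \<in> sets M" "\<And>\<omega>. \<omega> \<in> space M \<Longrightarrow> m \<omega> \<le> K"
    and W: "\<And>n. integrable M (W n)"
    and step: "\<And>n. (\<integral>\<omega>\<in>{\<omega>\<in>space M. n < m \<omega>}. W n \<omega> \<partial>M) \<le> (\<integral>\<omega>\<in>{\<omega>\<in>space M. n < m \<omega>}. W (Suc n) \<omega> \<partial>M)"
  shows "integrable M (\<lambda>\<omega>. W (m \<omega>) \<omega>)" "(\<integral>\<omega>. W 0 \<omega> \<partial>M) \<le> (\<integral>\<omega>. W (m \<omega>) \<omega> \<partial>M)"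
proof -
  have "integrable M (\<lambda>\<omega>. W (min n (m \<omega>)) \<omega>) \<and> (\<integral>\<omega>. W 0 \<omega> \<partial>M) \<le> (\<integral>\<omega>. W (min n (m \<omega>)) \<omega> \<partial>M)" for n
  proof (induction n)
    case 0
    then show ?case
      using W[of 0] by simp
  next
    case (Suc n)
    let ?A = "{\<omega>\<in>space M. n < m \<omega>}"
    have A: "?A \<in> sets M"
      by (rule m)
    have int: "integrable M (\<lambda>\<omega>. W (min n (m \<omega>)) \<omega>)"
      "integrable M (\<lambda>\<omega>. indicator ?A \<omega> *\<^sub>R W n' \<omega>)" for n'
      using Suc.IH integrable_mult_indicator[OF A W] by auto
    have eq: "W (min (Suc n) (m \<omega>)) \<omega>
        = (W (min n (m \<omega>)) \<omega> + indicator ?A \<omega> *\<^sub>R W (Suc n) \<omega>) - indicator ?A \<omega> *\<^sub>R W n \<omega>"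
      if "\<omega> \<in> space M" for \<omega>
    proof (cases "n < m \<omega>")
      case True
      then show ?thesis
        using that by (simp add: min_absorb1 Suc_leI)
    next
      case False
      then show ?thesis
        by (simp add: min_absorb2)
    qed
    have "integrable M (\<lambda>\<omega>. W (min (Suc n) (m \<omega>)) \<omega>)"
      by (subst Bochner_Integration.integrable_cong[OF refl eq])
        (auto simp del: real_scaleR_def intro!: Bochner_Integration.integrable_add
          Bochner_Integration.integrable_diff int)
    moreover have "(\<integral>\<omega>. W (min (Suc n) (m \<omega>)) \<omega> \<partial>M) = ((\<integral>\<omega>. W (min n (m \<omega>)) \<omega> \<partial>M)
        + (\<integral>\<omega>\<in>?A. W (Suc n) \<omega> \<partial>M)) - (\<integral>\<omega>\<in>?A. W n \<omega> \<partial>M)"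
      unfolding set_lebesgue_integral_def
      by (subst Bochner_Integration.integral_cong[OF refl eq], assumption)
        (simp only: Bochner_Integration.integral_add Bochner_Integration.integral_diff
          Bochner_Integration.integrable_add int)
    ultimately show ?case
      using Suc.IH step[of n] by simp
  qed
  note this[of K]
  moreover have "W (min K (m \<omega>)) \<omega> = W (m \<omega>) \<omega>" if "\<omega> \<in> space M" for \<omega>
    using m(2)[OF that] by (simp add: min_absorb2)
  ultimately show "integrable M (\<lambda>\<omega>. W (m \<omega>) \<omega>)" "(\<integral>\<omega>. W 0 \<omega> \<partial>M) \<le> (\<integral>\<omega>. W (m \<omega>) \<omega> \<partial>M)"
    by (simp_all cong: Bochner_Integration.integrable_cong Bochner_Integration.integral_cong)
qed

section \<open>The finite grid of times and rounding up\<close>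

definition grid_time :: "real \<Rightarrow> nat \<Rightarrow> nat \<Rightarrow> ennreal" where
  "grid_time h N n = (if n \<le> N then ennreal (real n * h) else \<infinity>)"

definition grid_pos :: "real \<Rightarrow> nat \<Rightarrow> ennreal \<Rightarrow> nat" where
  "grid_pos h N t = (LEAST n. t \<le> grid_time h N n)"

context
  fixes h :: real and N :: nat
  assumes h: "h > 0"
begin

lemma grid_time_mono: "m \<le> n \<Longrightarrow> grid_time h N m \<le> grid_time h N n"
  using h by (auto simp: grid_time_def intro!: ennreal_leI)

lemma grid_time_strict_mono: "m < n \<Longrightarrow> m \<le> N \<Longrightarrow> grid_time h N m < grid_time h N n"
  using h by (auto simp: grid_time_def ennreal_less_iff)

text \<open>Rounding up is adjoint to \<open>grid_time\<close>. In this form, questions about the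
  rounded position of a stopping time become events of the form {\<tau> \<le> g n}.\<close>

lemma le_grid_time_iff: "t \<le> grid_time h N n \<longleftrightarrow> grid_pos h N t \<le> n"
proof
  show "t \<le> grid_time h N n \<Longrightarrow> grid_pos h N t \<le> n"
    unfolding grid_pos_def by (rule Least_le)
  have "t \<le> grid_time h N (Suc N)"
    by (simp add: grid_time_def)
  then have "t \<le> grid_time h N (grid_pos h N t)"
    unfolding grid_pos_def by (rule LeastI)
  then show "grid_pos h N t \<le> n \<Longrightarrow> t \<le> grid_time h N n"
    using grid_time_mono order_trans by blast
qed

lemma grid_pos_le: "grid_pos h N t \<le> Suc N"
  by (simp flip: le_grid_time_iff add: grid_time_def)

lemma grid_time_pos_le:
  assumes "t \<le> grid_time h N N"
  shows "grid_time h N (grid_pos h N t) \<le> t + ennreal h"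
proof (cases "grid_pos h N t")
  case 0
  then show ?thesis
    by (simp add: grid_time_def)
next
  case (Suc k)
  have "Suc k \<le> N"
    using assms Suc by (simp add: le_grid_time_iff)
  have "\<not> t \<le> grid_time h N k"
    using Suc by (simp add: le_grid_time_iff)
  then have "ennreal (real k * h) + ennreal h \<le> t + ennreal h"
    using \<open>Suc k \<le> N\<close> by (simp add: grid_time_def add_right_mono)
  also have "ennreal (real k * h) + ennreal h = grid_time h N (Suc k)"
    using \<open>Suc k \<le> N\<close> h by (simp add: grid_time_def ennreal_plus[symmetric] algebra_simps del: ennreal_plus)
  finally show ?thesis
    by (simp add: Suc)
qed

text \<open>The second alternative is there because every index beyond N stands for
  \<infinity>.\<close>

lemma grid_time_less_cancel: "i \<le> Suc N \<Longrightarrow> grid_time h N i \<le> grid_time h N n \<longleftrightarrow> i \<le> n \<or> N < n"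
proof (cases "N < n")
  case True
  then show ?thesis
    by (simp add: grid_time_def)
next
  case False
  then show ?thesis
    using grid_time_mono[of i n] grid_time_strict_mono[of n i] by (meson leD leI)
qed

text \<open>By monotonicity of the grid, the hit occurs by time s exactly if some P n holds at a
  grid time not exceeding s. These are countably many events known at s.\<close>

lemma stopping_time_first_hit:
  assumes F: "filtration \<Omega> F"
    and P: "\<And>n. Measurable.pred (F (grid_time h N n)) (P n)" and ex: "\<And>\<omega>. \<exists>n. P n \<omega>"
  shows "stopping_time F (\<lambda>\<omega>. grid_time h N (LEAST n. P n \<omega>))"
proof
  fix s
  have eq: "grid_time h N (LEAST n. P n \<omega>) \<le> s \<longleftrightarrow> (\<exists>n\<in>{n. grid_time h N n \<le> s}. P n \<omega>)" for \<omega>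
    using LeastI_ex[OF ex, of \<omega>] Least_le[of "\<lambda>n. P n \<omega>"] grid_time_mono order_trans by blast
  have "Measurable.pred (F s) (P n)" if "grid_time h N n \<le> s" for n
    using P[of n] filtration.sets_F_mono[OF F that]
    by (auto simp: pred_def filtration.space_F[OF F])
  then show "Measurable.pred (F s) (\<lambda>\<omega>. grid_time h N (LEAST n. P n \<omega>) \<le> s)"
    unfolding eq by (intro measurable_pred_countable) auto
qed

end

section \<open>Behaviour of the payoff near infinity\<close>

context stopping_game
begin

text \<open>The joint limit controls U a t for large finite a and t. Fixing t and letting a run to
  \<infinity> along the integers carries the bound over to U \<infinity> t.\<close>

lemma U_infinity_tail:
  assumes \<omega>: "\<omega> \<in> space M" and e: "e > 0"
  shows "\<exists>b<\<infinity>. \<forall>t>b. \<bar>U \<infinity> t \<omega> - U \<infinity> \<infinity> \<omega>\<bar> \<le> e"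
proof -
  have "eventually (\<lambda>(a, b). dist (U a b \<omega>) (U \<infinity> \<infinity> \<omega>) < e) (at \<infinity> \<times>\<^sub>F at \<infinity>)"
    using tendstoD[OF U_lim_both[OF \<omega>] e] by (simp add: case_prod_beta')
  then obtain P Q where P: "eventually P (at (\<infinity> :: ennreal))" and Q: "eventually Q (at (\<infinity> :: ennreal))"
    and PQ: "\<And>a b. P a \<Longrightarrow> Q b \<Longrightarrow> dist (U a b \<omega>) (U \<infinity> \<infinity> \<omega>) < e"
    unfolding eventually_prod_filter by auto
  obtain b where b: "b < top" "\<And>t. b < t \<Longrightarrow> t \<noteq> top \<Longrightarrow> Q t"
    using Q eventually_nhds_top[of "0 :: ennreal" "\<lambda>t. t \<noteq> top \<longrightarrow> Q t"]
    by (auto simp: eventually_at_filter)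
  have "\<bar>U \<infinity> t \<omega> - U \<infinity> \<infinity> \<omega>\<bar> \<le> e" if t: "b < t" for t
  proof (cases "t = \<infinity>")
    case True
    then show ?thesis
      using e by simp
  next
    case False
    then have "t < \<infinity>"
      using ennreal_cases_infinity by blast
    have lim: "(\<lambda>n. \<bar>U (of_nat n) t \<omega> - U \<infinity> \<infinity> \<omega>\<bar>) \<longlonglongrightarrow> \<bar>U \<infinity> t \<omega> - U \<infinity> \<infinity> \<omega>\<bar>"
      using U_limits(2)[OF \<omega> \<open>t < \<infinity>\<close>] by (intro tendsto_intros)
    have "eventually (\<lambda>n. P (of_nat n)) sequentially"
      using of_nat_at_infinity P by (auto simp: filterlim_iff)
    then have "eventually (\<lambda>n. \<bar>U (of_nat n) t \<omega> - U \<infinity> \<infinity> \<omega>\<bar> \<le> e) sequentially"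
      using PQ[OF _ b(2)[OF t]] False by (auto elim!: eventually_mono simp: dist_real_def less_imp_le)
    then show ?thesis
      by (rule tendsto_upperbound[OF lim]) simp
  qed
  then show ?thesis
    using b(1) by auto
qed

text \<open>D n is the largest drop of U \<infinity> t below U \<infinity> \<infinity> over t \<ge>
  n. It tends to 0 at every point and is bounded by twice the bound on U, so its mean tends to 0 by
  dominated convergence.\<close>

lemma tail_error:
  assumes \<delta>: "\<delta> > 0"
  shows "\<exists>n D. integrable M D \<and> (\<integral>\<omega>. D \<omega> \<partial>M) < \<delta> \<and> (\<forall>\<omega>\<in>space M. 0 \<le> D \<omega>) \<and>
    (\<forall>t\<ge>of_nat n. \<forall>\<omega>\<in>space M. U \<infinity> \<infinity> \<omega> - D \<omega> \<le> U \<infinity> t \<omega>)"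
proof -
  define D where "D n \<omega> = (SUP t\<in>{of_nat n..}. U \<infinity> \<infinity> \<omega> - U \<infinity> t \<omega>)" for n :: nat and \<omega>
  have le: "U \<infinity> \<infinity> \<omega> - U \<infinity> t \<omega> \<le> 2 * U_bound" if "\<omega> \<in> space M" for t \<omega>
    using abs_U_le[OF that, of \<infinity> \<infinity>] abs_U_le[OF that, of \<infinity> t] by linarith
  have bdd: "bdd_above ((\<lambda>t. U \<infinity> \<infinity> \<omega> - U \<infinity> t \<omega>) ` A)" if "\<omega> \<in> space M" for \<omega> A
    using le[OF that] by (intro bdd_aboveI2[where M = "2 * U_bound"])
  have upper: "U \<infinity> \<infinity> \<omega> - U \<infinity> t \<omega> \<le> D n \<omega>" if "\<omega> \<in> space M" "of_nat n \<le> t" for n t \<omega>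
    unfolding D_def using that by (intro cSUP_upper bdd) auto
  have nonneg: "0 \<le> D n \<omega>" if "\<omega> \<in> space M" for n \<omega>
    using upper[OF that, of n \<infinity>] by simp
  have least: "D n \<omega> \<le> c" if "\<And>t. of_nat n \<le> t \<Longrightarrow> U \<infinity> \<infinity> \<omega> - U \<infinity> t \<omega> \<le> c" for n \<omega> c
    unfolding D_def using that by (intro cSUP_least) auto
  have bound: "\<bar>D n \<omega>\<bar> \<le> 2 * U_bound" if "\<omega> \<in> space M" for n \<omega>
    using nonneg[OF that] least[OF le[OF that]] by simp
  \<comment> \<open>A supremum over uncountably many t, measurable because every U \<infinity> t is
    constant on the atoms of \<open>F \<infinity>\<close>.\<close>
  have meas: "D n \<in> borel_measurable M" for n
  proof (rule measurable_from_F[of _ \<infinity>], rule measurable_constant_on_atoms[OF subalgebra_F])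
    fix \<omega> \<omega>' assume *: "\<omega> \<in> space M" "\<omega>' \<in> atom (F \<infinity>) \<omega>"
    have "measurable (F \<infinity>) borel = measurable M (borel :: real measure)"
      by (rule measurable_cong_sets) (simp_all add: sets_M)
    then have "U \<infinity> t \<omega>' = U \<infinity> t \<omega>" for t
      using U_measurable by (intro at_time.measurable_const_atom[OF _ *]) simp
    then show "D n \<omega>' = D n \<omega>"
      by (simp add: D_def)
  qed simp
  have "(\<lambda>n. D n \<omega>) \<longlonglongrightarrow> 0" if \<omega>: "\<omega> \<in> space M" for \<omega>
  proof (rule LIMSEQ_I)
    fix e :: real assume e: "0 < e"
    obtain b where b: "b < \<infinity>" "\<And>t. b < t \<Longrightarrow> \<bar>U \<infinity> t \<omega> - U \<infinity> \<infinity> \<omega>\<bar> \<le> e / 2"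
      using U_infinity_tail[OF \<omega>, of "e / 2"] e by auto
    obtain n0 where n0: "b < of_nat n0"
      using ennreal_Ex_less_of_nat[of b] b(1) by auto
    have "norm (D n \<omega> - 0) < e" if "n \<ge> n0" for n
    proof -
      have "b < t" if "of_nat n \<le> t" for t
        using n0 that \<open>n \<ge> n0\<close> by (metis less_le_trans of_nat_mono)
      then have "\<bar>U \<infinity> t \<omega> - U \<infinity> \<infinity> \<omega>\<bar> \<le> e / 2" if "of_nat n \<le> t" for t
        using b(2) that by blast
      then have "D n \<omega> \<le> e / 2"
        by (intro least) (smt (verit))
      then show ?thesis
        using nonneg[OF \<omega>, of n] e by simp
    qed
    then show "\<exists>n0. \<forall>n\<ge>n0. norm (D n \<omega> - 0) < e"
      by blast
  qed
  then have "(\<lambda>n. \<integral>\<omega>. D n \<omega> \<partial>M) \<longlonglongrightarrow> (\<integral>\<omega>. 0 \<partial>M)"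
    using meas bound by (intro integral_dominated_convergence[where w = "\<lambda>_. 2 * U_bound"]) auto
  then have "eventually (\<lambda>n. (\<integral>\<omega>. D n \<omega> \<partial>M) < \<delta>) sequentially"
    using \<delta> by (intro order_tendstoD(2)) auto
  then obtain n where "(\<integral>\<omega>. D n \<omega> \<partial>M) < \<delta>"
    by (auto simp: eventually_sequentially)
  moreover have "U \<infinity> \<infinity> \<omega> - D n \<omega> \<le> U \<infinity> t \<omega>" if "\<omega> \<in> space M" "of_nat n \<le> t" for t \<omega>
    using upper[OF that] by simp
  ultimately show ?thesis
    using nonneg integrable_bounded[OF meas bound] by (intro exI[of _ n] exI[of _ "D n"]) auto
qed

end

context uniform_stopping_game
begin

text \<open>Up to the last finite grid time, rounding moves t by at most h. Later times are rounded
  to \<infinity>, where Y is U \<infinity> \<infinity>; there D bridges to U \<infinity> t, which is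
  the outcome of the admissible reaction of never stopping and so is dominated by Y t in conditional
  mean.\<close>

lemma cexp_rounded_Y_le:
  assumes h: "h > 0" and D: "integrable M D" "\<And>\<omega>. \<omega> \<in> space M \<Longrightarrow> 0 \<le> D \<omega>"
    "\<And>t \<omega>. grid_time h N N \<le> t \<Longrightarrow> \<omega> \<in> space M \<Longrightarrow> U \<infinity> \<infinity> \<omega> - D \<omega> \<le> U \<infinity> t \<omega>"
    and \<omega>: "\<omega> \<in> space M"
  shows "cexp t (\<lambda>\<omega>'. Y (grid_time h N (grid_pos h N t)) \<omega>' - D \<omega>') \<omega> \<le> Y t \<omega> + r (ennreal h)"
proof -
  let ?s = "grid_time h N (grid_pos h N t)"
  have at: "\<omega>' \<in> space M" if "\<omega>' \<in> atom (F t) \<omega>" for \<omega>'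
    using that by (simp add: atom_def)
  have int: "integrable M (\<lambda>\<omega>'. Y ?s \<omega>' - D \<omega>')" "integrable M (U \<infinity> t)"
    using Y_integrable D(1) integrable_bounded[OF U_measurable abs_U_le] by auto
  show ?thesis
  proof (cases "t \<le> grid_time h N N")
    case True
    have "cexp t (\<lambda>\<omega>'. Y ?s \<omega>' - D \<omega>') \<omega> \<le> cexp t (Y ?s) \<omega>"
      using D(2)[OF at] by (intro at_time.ce_mono int Y_integrable \<omega>) auto
    also have "\<dots> \<le> Y t \<omega> + r (ennreal h)"
      using le_grid_time_iff[OF h, of t N "grid_pos h N t"] grid_time_pos_le[OF h True]
      by (intro cexp_Y_le \<omega>) auto
    finally show ?thesis .
  next
    case False
    then have "N < grid_pos h N t"
      using le_grid_time_iff[OF h, of t N N] by simp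
    then have s: "?s = \<infinity>"
      by (simp add: grid_time_def)
    have "cexp t (\<lambda>\<omega>'. Y ?s \<omega>' - D \<omega>') \<omega> \<le> cexp t (U \<infinity> t) \<omega>"
    proof (rule at_time.ce_mono[OF int \<omega>])
      fix \<omega>' assume "\<omega>' \<in> atom (F t) \<omega>"
      from at[OF this] show "Y ?s \<omega>' - D \<omega>' \<le> U \<infinity> t \<omega>'"
        unfolding s using D(3)[of t \<omega>'] False by (simp add: Y_infinity[simplified])
    qed
    also have "\<dots> \<le> Y t \<omega>"
      using cexp_le_Y[OF const_times_from[of t \<infinity>] \<omega>] by simp
    finally show ?thesis
      using r_nonneg[of "ennreal h"] by simp
  qed
qed

text \<open>
  As \<open>\<tau>\<close> is not restricted to the grid, the value process is stopped at the grid position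
  of \<open>\<tau>\<close> rounded up.
\<close>

lemma dynkin_payoff_lower_bound:
  assumes h: "h > 0" and D: "integrable M D" "(\<integral>\<omega>. D \<omega> \<partial>M) \<le> \<delta>" "\<And>\<omega>. \<omega> \<in> space M \<Longrightarrow> 0 \<le> D \<omega>"
    "\<And>t \<omega>. grid_time h N N \<le> t \<Longrightarrow> \<omega> \<in> space M \<Longrightarrow> U \<infinity> \<infinity> \<omega> - D \<omega> \<le> U \<infinity> t \<omega>"
    and W: "\<And>n. integrable M (W n)"
    and i: "\<And>\<omega>. i \<omega> \<le> Suc N" "stopping_time F (\<lambda>\<omega>. grid_time h N (i \<omega>))"
    and W_step: "\<And>n \<omega>. \<omega> \<in> space M \<Longrightarrow> n < i \<omega> \<Longrightarrow> W n \<omega> \<le> cexp (grid_time h N n) (W (Suc n)) \<omega>"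
    and W_Y: "\<And>n \<omega>. \<omega> \<in> space M \<Longrightarrow> n < i \<omega> \<Longrightarrow> W n \<omega> \<le> Y (grid_time h N n) \<omega>"
    and W_X: "\<And>\<omega>. \<omega> \<in> space M \<Longrightarrow> i \<omega> \<le> N \<Longrightarrow> W (i \<omega>) \<omega> \<le> X (grid_time h N (i \<omega>)) \<omega>"
    and W_end: "\<And>\<omega>. \<omega> \<in> space M \<Longrightarrow> W (Suc N) \<omega> \<le> U \<infinity> \<infinity> \<omega>"
    and \<tau>: "stopping_time F \<tau>"
  shows "(\<integral>\<omega>. W 0 \<omega> \<partial>M) \<le> V (\<lambda>\<omega>. grid_time h N (i \<omega>)) \<tau> + r (ennreal h) + \<delta>"
proof -
  define g where "g = grid_time h N"
  define \<rho> where "\<rho> \<omega> = g (i \<omega>)" for \<omega>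
  define j where "j \<omega> = grid_pos h N (\<tau> \<omega>)" for \<omega>
  define m where "m \<omega> = min (i \<omega>) (j \<omega>)" for \<omega>
  have \<rho>: "stopping_time F \<rho>"
    using i(2) by (simp add: \<rho>_def[abs_def] g_def)
  have \<rho>_le: "\<rho> \<omega> \<le> g n \<longleftrightarrow> i \<omega> \<le> n \<or> N < n" for \<omega> n
    using grid_time_less_cancel[OF h i(1)] by (simp add: \<rho>_def g_def)
  have \<tau>_le: "\<tau> \<omega> \<le> g n \<longleftrightarrow> j \<omega> \<le> n" for \<omega> n
    using le_grid_time_iff[OF h] by (simp add: g_def j_def)
  have j_le: "j \<omega> \<le> Suc N" for \<omega>
    using grid_pos_le[OF h] by (simp add: j_def)
  have sets_m: "{\<omega>\<in>space M. n < m \<omega>} \<in> sets (F (g n))" for n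
  proof -
    \<comment> \<open>For n beyond N both sides are false: i and j are at most N + 1, and g n is
      then \<infinity>.\<close>
    have "n < m \<omega> \<longleftrightarrow> \<not> \<rho> \<omega> \<le> g n \<and> \<not> \<tau> \<omega> \<le> g n" for \<omega>
      using i(1)[of \<omega>] j_le[of \<omega>] unfolding \<rho>_le \<tau>_le m_def by auto
    moreover have "Measurable.pred (F (g n)) (\<lambda>\<omega>. \<not> \<rho> \<omega> \<le> g n \<and> \<not> \<tau> \<omega> \<le> g n)"
      by (intro pred_intros_logic stopping_timeD \<rho> \<tau>)
    ultimately show ?thesis
      by (simp add: pred_def space_F)
  qed
  have F_M: "A \<in> sets M" if "A \<in> sets (F t)" for A t
    using subalgebra_F[of t] that by (auto simp: subalgebra_def)
  have step: "(\<integral>\<omega>\<in>{\<omega>\<in>space M. n < m \<omega>}. W n \<omega> \<partial>M) \<le> (\<integral>\<omega>\<in>{\<omega>\<in>space M. n < m \<omega>}. W (Suc n) \<omega> \<partial>M)" for n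
  proof -
    have "(\<integral>\<omega>\<in>{\<omega>\<in>space M. n < m \<omega>}. W n \<omega> \<partial>M) \<le> (\<integral>\<omega>\<in>{\<omega>\<in>space M. n < m \<omega>}. cexp (g n) (W (Suc n)) \<omega> \<partial>M)"
      using W_step F_M[OF sets_m]
      by (intro set_integral_mono set_integrable_of_integrable W at_time.real_cond_exp_int(1))
        (auto simp: g_def m_def)
    also have "\<dots> = (\<integral>\<omega>\<in>{\<omega>\<in>space M. n < m \<omega>}. W (Suc n) \<omega> \<partial>M)"
      by (rule at_time.real_cond_exp_intA[symmetric, OF W sets_m])
    finally show ?thesis .
  qed
  have m_le: "m \<omega> \<le> Suc N" for \<omega>
    using i(1)[of \<omega>] by (simp add: m_def)
  note stopped = integral_le_stopped[OF F_M[OF sets_m] m_le W step]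
  note [measurable] = stopping_time_measurable[OF \<rho>] stopping_time_measurable[OF \<tau>]
  have g_j: "(\<lambda>\<omega>. g (j \<omega>)) \<in> borel_measurable M"
  proof (rule borel_measurableI_le)
    fix t
    have "{\<omega> \<in> space M. g (j \<omega>) \<le> t} = (\<Union>n\<in>{n. g n \<le> t}. {\<omega> \<in> space M. \<tau> \<omega> \<le> g n})"
      unfolding \<tau>_le using grid_time_mono[OF h, of _ _ N, folded g_def] by (blast intro: order_trans)
    also have "\<dots> \<in> sets M"
      by measurable
    finally show "{\<omega> \<in> space M. g (j \<omega>) \<le> t} \<in> sets M" .
  qed
  let ?Yj = "\<lambda>\<omega>. Y (g (j \<omega>)) \<omega>"
  have int: "integrable M (\<lambda>\<omega>. X (\<rho> \<omega>) \<omega>)" "integrable M (\<lambda>\<omega>. Y (\<tau> \<omega>) \<omega>)"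
    "integrable M (\<lambda>\<omega>. U (\<rho> \<omega>) (\<rho> \<omega>) \<omega>)" "integrable M ?Yj"
    by (intro X_at_integrable Y_at_integrable U_at_integrable g_j stopping_time_measurable \<rho> \<tau>)+
  let ?A = "{\<omega>\<in>space M. \<rho> \<omega> < \<tau> \<omega>}" and ?B = "{\<omega>\<in>space M. \<tau> \<omega> < \<rho> \<omega>}"
    and ?E = "{\<omega>\<in>space M. \<rho> \<omega> = \<tau> \<omega>}"
  define q where "q \<omega> = (if \<rho> \<omega> < \<tau> \<omega> then X (\<rho> \<omega>) \<omega> else if \<tau> \<omega> < \<rho> \<omega> then ?Yj \<omega>
    else U (\<rho> \<omega>) (\<rho> \<omega>) \<omega>)" for \<omega>
  have W_Z: "W (i \<omega>) \<omega> \<le> U (\<rho> \<omega>) (\<rho> \<omega>) \<omega>" if \<omega>: "\<omega> \<in> space M" for \<omega>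
  proof (cases "i \<omega> \<le> N")
    case True
    then show ?thesis
      using W_X[OF \<omega>] X_le_Z[OF \<omega>, of "\<rho> \<omega>"] by (simp add: \<rho>_def g_def)
  next
    case False
    then have "i \<omega> = Suc N"
      using i(1)[of \<omega>] by simp
    then show ?thesis
      using W_end[OF \<omega>] by (simp add: \<rho>_def g_def grid_time_def)
  qed
  have W_q: "W (m \<omega>) \<omega> \<le> q \<omega>" if \<omega>: "\<omega> \<in> space M" for \<omega>
  proof -
    consider "\<rho> \<omega> < \<tau> \<omega>" | "\<tau> \<omega> < \<rho> \<omega>" | "\<tau> \<omega> = \<rho> \<omega>"
      by (meson linorder_cases)
    then show ?thesis
    proof cases
      case 1
      \<comment> \<open>As j is at most N + 1, this forces i \<le> N, so the maximizer stops at a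
        finite grid time and \<open>W_X\<close> applies.\<close>
      then have "i \<omega> < j \<omega>"
        using \<tau>_le[of \<omega> "i \<omega>"] by (simp add: \<rho>_def flip: not_le)
      then show ?thesis
        using 1 W_X[OF \<omega>] j_le[of \<omega>] by (simp add: q_def m_def \<rho>_def g_def)
    next
      case 2
      then have "j \<omega> \<le> i \<omega>"
        using \<tau>_le[of \<omega> "i \<omega>"] by (simp add: \<rho>_def less_imp_le)
      then consider "j \<omega> < i \<omega>" | "j \<omega> = i \<omega>"
        by linarith
      then have "W (m \<omega>) \<omega> \<le> ?Yj \<omega>"
      proof cases
        case 1
        then show ?thesis
          using W_Y[OF \<omega> 1] by (simp add: m_def g_def)
      next
        \<comment> \<open>Rounding has merged the two times although \<tau> comes strictly first.
          The payoff due is Y, while W is only known to be at most Z; the order Z \<le> Y closes the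
          gap.\<close>
        case 2
        then show ?thesis
          using W_Z[OF \<omega>] Z_le_Y[OF \<omega>, of "\<rho> \<omega>"] by (simp add: m_def \<rho>_def)
      qed
      then show ?thesis
        using 2 by (auto simp: q_def)
    next
      case 3
      then have "j \<omega> \<le> i \<omega>"
        using \<tau>_le[of \<omega> "i \<omega>"] by (simp add: \<rho>_def)
      moreover have "\<rho> \<omega> \<le> g (j \<omega>)"
        using 3 \<tau>_le[of \<omega> "j \<omega>"] by simp
      then have "i \<omega> \<le> j \<omega>"
        unfolding \<rho>_le using i(1)[of \<omega>] by auto
      ultimately show ?thesis
        using 3 W_Z[OF \<omega>] by (simp add: q_def m_def)
    qed
  qed
  have B: "?B \<in> sets (pre_sigma \<tau>)"
    using stopping_time_less[OF \<tau> \<rho>] by (simp add: pred_def space_pre_sigma)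
  have BM: "?B \<in> sets M"
    by measurable
  have q_int: "integrable M q"
    unfolding q_def by (rule integrable_trichotomy[OF _ _ int(1,4,3)]) measurable
  have "(\<integral>\<omega>. W 0 \<omega> \<partial>M) \<le> (\<integral>\<omega>. W (m \<omega>) \<omega> \<partial>M)"
    by (rule stopped)
  also have "\<dots> \<le> (\<integral>\<omega>. q \<omega> \<partial>M)"
    using W_q by (intro integral_mono stopped q_int)
  also have "\<dots> = (\<integral>\<omega>\<in>?A. X (\<rho> \<omega>) \<omega> \<partial>M) + (\<integral>\<omega>\<in>?B. ?Yj \<omega> \<partial>M) + (\<integral>\<omega>\<in>?E. U (\<rho> \<omega>) (\<rho> \<omega>) \<omega> \<partial>M)"
    unfolding q_def by (rule integral_trichotomy[OF _ _ int(1,4,3)]) measurable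
  finally have 1: "(\<integral>\<omega>. W 0 \<omega> \<partial>M) \<le> \<dots>" .
  have si: "set_integrable M ?B f" if "integrable M f" for f :: "'a \<Rightarrow> real"
    using that BM by (rule set_integrable_of_integrable)
  \<comment> \<open>D depends on the far future and need not be known at time \<tau>, so it is kept
    inside the conditional expectation and its mean is accounted for afterwards.\<close>
  have "(\<integral>\<omega>\<in>?B. ?Yj \<omega> - D \<omega> \<partial>M) \<le> (\<integral>\<omega>\<in>?B. Y (\<tau> \<omega>) \<omega> + r (ennreal h) \<partial>M)"
    unfolding j_def g_def
  proof (rule set_integral_at_stopping_time_mono[OF \<tau> B,
        where f = "\<lambda>t \<omega>. Y (grid_time h N (grid_pos h N t)) \<omega> - D \<omega>" and g = "\<lambda>t \<omega>. Y t \<omega> + r (ennreal h)"])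
    show "integrable M (\<lambda>\<omega>. Y (grid_time h N (grid_pos h N t)) \<omega> - D \<omega>)" for t
      using Y_integrable D(1) by simp
    show "integrable M (\<lambda>\<omega>. Y (grid_time h N (grid_pos h N (\<tau> \<omega>))) \<omega> - D \<omega>)"
      using int(4) D(1) by (simp add: j_def g_def)
    show "integrable M (\<lambda>\<omega>. Y (\<tau> \<omega>) \<omega> + r (ennreal h))"
      using int(2) by simp
  qed (rule cexp_rounded_Y_le[OF h D(1,3,4)], auto)
  also have "\<dots> = (\<integral>\<omega>\<in>?B. Y (\<tau> \<omega>) \<omega> \<partial>M) + (\<integral>\<omega>\<in>?B. r (ennreal h) \<partial>M)"
    by (rule set_integral_add(2)[OF si[OF int(2)] si]) simp
  also have "(\<integral>\<omega>\<in>?B. r (ennreal h) \<partial>M) = r (ennreal h) * prob ?B"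
    using BM by (subst set_integral_const) auto
  also have "\<dots> \<le> r (ennreal h)"
    using r_nonneg by (simp add: mult_left_le)
  also have "(\<integral>\<omega>\<in>?B. ?Yj \<omega> - D \<omega> \<partial>M) = (\<integral>\<omega>\<in>?B. ?Yj \<omega> \<partial>M) - (\<integral>\<omega>\<in>?B. D \<omega> \<partial>M)"
    by (rule set_integral_diff(2)[OF si[OF int(4)] si[OF D(1)]])
  finally have 2: "(\<integral>\<omega>\<in>?B. ?Yj \<omega> \<partial>M) - (\<integral>\<omega>\<in>?B. D \<omega> \<partial>M)
    \<le> (\<integral>\<omega>\<in>?B. Y (\<tau> \<omega>) \<omega> \<partial>M) + r (ennreal h)"
    by simp
  have "(\<integral>\<omega>\<in>?B. D \<omega> \<partial>M) \<le> (\<integral>\<omega>. D \<omega> \<partial>M)"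
    unfolding set_lebesgue_integral_def using D(3)
    by (intro integral_mono integrable_mult_indicator BM D(1)) (auto simp: indicator_def)
  with 2 D(2) have 3: "(\<integral>\<omega>\<in>?B. ?Yj \<omega> \<partial>M) \<le> (\<integral>\<omega>\<in>?B. Y (\<tau> \<omega>) \<omega> \<partial>M) + r (ennreal h) + \<delta>"
    by linarith
  have "V \<rho> \<tau> = (\<integral>\<omega>\<in>?A. X (\<rho> \<omega>) \<omega> \<partial>M) + (\<integral>\<omega>\<in>?B. Y (\<tau> \<omega>) \<omega> \<partial>M) + (\<integral>\<omega>\<in>?E. U (\<rho> \<omega>) (\<rho> \<omega>) \<omega> \<partial>M)"
    unfolding dynkin_payoff_def proc_Z_def
    by (rule integral_trichotomy[OF _ _ int(1-3)]) measurable
  with 1 3 show ?thesis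
    by (simp add: \<rho>_def[abs_def] g_def)
qed

end

section \<open>Existence of saddle points and equilibria\<close>

context uniform_stopping_game
begin

text \<open>
  The third argument counts the stages left: $W_n$ is \<open>backward_value h N (N + 1 - n)\<close>.
\<close>

primrec backward_value :: "real \<Rightarrow> nat \<Rightarrow> nat \<Rightarrow> 'a \<Rightarrow> real" where
  "backward_value h N 0 = U \<infinity> \<infinity>"
| "backward_value h N (Suc k) = (\<lambda>\<omega>. let t = grid_time h N (N - k)
     in max (X t \<omega>) (min (Y t \<omega>) (cexp t (backward_value h N k) \<omega>)))"

lemma backward_value_integrable: "integrable M (backward_value h N k)"
proof (induction k)
  case 0
  then show ?case
    using integrable_bounded[OF U_measurable abs_U_le] by simp
next
  case (Suc k)
  then show ?case
    using X_at_integrable[of "\<lambda>_. grid_time h N (N - k)"] Y_integrable[of "grid_time h N (N - k)"]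
    by (auto simp: Let_def intro!: Bochner_Integration.integrable_max Bochner_Integration.integrable_min
        at_time.real_cond_exp_int(1))
qed

text \<open>The two grid strategies guarantee more than w - \<epsilon> / 2 and less than w +
  \<epsilon> / 2 respectively, w being the mean of \<open>W 0\<close>. Their own payoff lies within
  the same bounds, which yields both saddle inequalities with error \<epsilon>.\<close>

lemma dynkin_saddle_point_exists:
  assumes \<epsilon>: "\<epsilon> > 0"
  shows "\<exists>\<rho> \<tau>. dynkin_saddle_point M F U \<epsilon> \<rho> \<tau>"
proof -
  interpret flip: uniform_stopping_game M F "\<lambda>s t \<omega>. - U t s \<omega>" r
    by (rule uniform_stopping_game_flip)
  obtain h where h: "h > 0" "r (ennreal h) + r (ennreal h + ennreal h) < \<epsilon> / 4"
    using small_mesh[of "\<epsilon> / 4"] \<epsilon> by auto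
  obtain n1 D1 where D1: "integrable M D1" "(\<integral>\<omega>. D1 \<omega> \<partial>M) < \<epsilon> / 4" "\<forall>\<omega>\<in>space M. 0 \<le> D1 \<omega>"
    "\<forall>t\<ge>of_nat n1. \<forall>\<omega>\<in>space M. U \<infinity> \<infinity> \<omega> - D1 \<omega> \<le> U \<infinity> t \<omega>"
    using tail_error[of "\<epsilon> / 4"] \<epsilon> by auto
  obtain n2 D2 where D2: "integrable M D2" "(\<integral>\<omega>. D2 \<omega> \<partial>M) < \<epsilon> / 4" "\<forall>\<omega>\<in>space M. 0 \<le> D2 \<omega>"
    "\<forall>t\<ge>of_nat n2. \<forall>\<omega>\<in>space M. - U \<infinity> \<infinity> \<omega> - D2 \<omega> \<le> - U t \<infinity> \<omega>"
    using flip.tail_error[of "\<epsilon> / 4"] \<epsilon> by auto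
  \<comment> \<open>The last finite grid time lies beyond both tail thresholds.\<close>
  obtain N :: nat where N: "real (max n1 n2) \<le> real N * h"
    using reals_Archimedean3[OF h(1)] by (meson less_imp_le)
  define g where "g = grid_time h N"
  have gN: "of_nat n \<le> t" if "n \<le> max n1 n2" "g N \<le> t" for n t
  proof -
    have "of_nat n = ennreal (real n)"
      by (simp add: ennreal_of_nat_eq_real_of_nat)
    also have "\<dots> \<le> g N"
      using that(1) N by (auto simp: g_def grid_time_def intro!: ennreal_leI)
    finally show ?thesis
      using that(2) by simp
  qed
  define W where "W n = backward_value h N (Suc N - n)" for n
  define C where "C n = cexp (g n) (W (Suc n))" for n
  have W_int: "integrable M (W n)" for n
    by (simp add: W_def backward_value_integrable)
  have W_end: "W (Suc N) = U \<infinity> \<infinity>"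
    by (simp add: W_def)
  have W_rec: "W n \<omega> = max (X (g n) \<omega>) (min (Y (g n) \<omega>) (C n \<omega>))" if "n \<le> N" for n \<omega>
    using that by (simp add: W_def C_def g_def Suc_diff_le Let_def)
  have X_le_Y: "X t \<omega> \<le> Y t \<omega>" if "\<omega> \<in> space M" for t \<omega>
    using X_le_Z[OF that, of t] Z_le_Y[OF that, of t] by linarith
  \<comment> \<open>The clause N < n makes both players stop at \<infinity> at the latest, so the
    least index exists. Before P holds, X \<le> C bounds W by both C and Y; when P holds at n \<le>
    N, W equals X. Dually, before Q holds W dominates both C and X, and when Q holds at n \<le> N it
    dominates Y.\<close>
  define P where "P n \<omega> \<longleftrightarrow> N < n \<or> C n \<omega> < X (g n) \<omega>" for n \<omega>
  define Q where "Q n \<omega> \<longleftrightarrow> N < n \<or> Y (g n) \<omega> < C n \<omega>" for n \<omega>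
  define i where "i \<omega> = (LEAST n. P n \<omega>)" for \<omega>
  define j where "j \<omega> = (LEAST n. Q n \<omega>)" for \<omega>
  have PQ_end: "P (Suc N) \<omega>" "Q (Suc N) \<omega>" for \<omega>
    by (simp_all add: P_def Q_def)
  have i: "i \<omega> \<le> Suc N" "P (i \<omega>) \<omega>" "n < i \<omega> \<Longrightarrow> \<not> P n \<omega>" for \<omega> n
    using Least_le[of "\<lambda>n. P n \<omega>", OF PQ_end(1)] LeastI[of "\<lambda>n. P n \<omega>", OF PQ_end(1)]
      not_less_Least[of n "\<lambda>n. P n \<omega>"] by (simp_all add: i_def)
  have j: "j \<omega> \<le> Suc N" "Q (j \<omega>) \<omega>" "n < j \<omega> \<Longrightarrow> \<not> Q n \<omega>" for \<omega> n
    using Least_le[of "\<lambda>n. Q n \<omega>", OF PQ_end(2)] LeastI[of "\<lambda>n. Q n \<omega>", OF PQ_end(2)]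
      not_less_Least[of n "\<lambda>n. Q n \<omega>"] by (simp_all add: j_def)
  have [measurable]: "C n \<in> borel_measurable (F (g n))" "X (g n) \<in> borel_measurable (F (g n))"
    "Y (g n) \<in> borel_measurable (F (g n))" for n
    by (simp_all add: C_def X_adapted Y_adapted)
  have "Measurable.pred (F (g n)) (P n)" "Measurable.pred (F (g n)) (Q n)" for n
    unfolding P_def Q_def by measurable
  then have st: "stopping_time F (\<lambda>\<omega>. g (i \<omega>))" "stopping_time F (\<lambda>\<omega>. g (j \<omega>))"
    using PQ_end unfolding g_def i_def j_def
    by (intro stopping_time_first_hit[OF h(1) filtration_axioms]; blast)+
  define w where "w = (\<integral>\<omega>. W 0 \<omega> \<partial>M)"
  have lower: "w - \<epsilon> / 2 < V (\<lambda>\<omega>. g (i \<omega>)) \<tau>" if \<tau>: "stopping_time F \<tau>" for \<tau>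
  proof -
    have "w \<le> V (\<lambda>\<omega>. g (i \<omega>)) \<tau> + r (ennreal h) + (\<integral>\<omega>. D1 \<omega> \<partial>M)"
      unfolding w_def g_def
    proof (rule dynkin_payoff_lower_bound[OF h(1) D1(1) order_refl _ _ W_int i(1)])
      show "U \<infinity> \<infinity> \<omega> - D1 \<omega> \<le> U \<infinity> t \<omega>" if "grid_time h N N \<le> t" "\<omega> \<in> space M" for t \<omega>
        using D1(4) gN[of n1 t] that by (simp add: g_def)
      fix n \<omega> assume \<omega>: "\<omega> \<in> space M" and n: "n < i \<omega>"
      have "n \<le> N" "X (g n) \<omega> \<le> C n \<omega>"
        using i(3)[OF n] by (simp_all add: P_def not_less)
      then show "W n \<omega> \<le> cexp (grid_time h N n) (W (Suc n)) \<omega>" "W n \<omega> \<le> Y (grid_time h N n) \<omega>"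
        using W_rec[of n \<omega>] X_le_Y[OF \<omega>, of "g n"] by (auto simp: C_def g_def)
    next
      fix \<omega> assume \<omega>: "\<omega> \<in> space M" and n: "i \<omega> \<le> N"
      then have "C (i \<omega>) \<omega> < X (g (i \<omega>)) \<omega>"
        using i(2)[of \<omega>] by (simp add: P_def)
      then show "W (i \<omega>) \<omega> \<le> X (grid_time h N (i \<omega>)) \<omega>"
        using W_rec[OF n, of \<omega>] by (simp add: g_def)
    qed (use D1(3) st(1) \<tau> W_end in \<open>auto simp: g_def\<close>)
    then show ?thesis
      using h(2) r_nonneg[of "ennreal h + ennreal h"] D1(2) by linarith
  qed
  have upper: "V \<rho> (\<lambda>\<omega>. g (j \<omega>)) < w + \<epsilon> / 2" if \<rho>: "stopping_time F \<rho>" for \<rho>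
  proof -
    \<comment> \<open>In the flipped game -W is the value process, and -Y and -X take the places of
      X and Y; the minimizer becomes the player whose guarantee is computed.\<close>
    have "(\<integral>\<omega>. - W 0 \<omega> \<partial>M) \<le> dynkin_payoff M F (\<lambda>s t \<omega>. - U t s \<omega>) (\<lambda>\<omega>. g (j \<omega>)) \<rho>
        + r (ennreal h) + (\<integral>\<omega>. D2 \<omega> \<partial>M)"
      unfolding g_def
    proof (rule flip.dynkin_payoff_lower_bound[OF h(1) D2(1) order_refl _ _ _ j(1),
          where W = "\<lambda>n \<omega>. - W n \<omega>"])
      show "- U \<infinity> \<infinity> \<omega> - D2 \<omega> \<le> - U t \<infinity> \<omega>" if "grid_time h N N \<le> t" "\<omega> \<in> space M" for t \<omega>
        using D2(4) gN[of n2 t] that by (simp add: g_def)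
      fix n \<omega> assume \<omega>: "\<omega> \<in> space M" and n: "n < j \<omega>"
      have "n \<le> N" "C n \<omega> \<le> Y (g n) \<omega>"
        using j(3)[OF n] by (simp_all add: Q_def not_less)
      then show "- W n \<omega> \<le> cexp (grid_time h N n) (\<lambda>\<omega>. - W (Suc n) \<omega>) \<omega>"
        "- W n \<omega> \<le> proc_Y M F (\<lambda>s t \<omega>. - U t s \<omega>) (grid_time h N n) \<omega>"
        using W_rec[of n \<omega>] X_le_Y[OF \<omega>, of "g n"]
        by (auto simp: C_def g_def at_time.ce_minus[OF W_int \<omega>] proc_Y_flip[OF \<omega>])
    next
      fix \<omega> assume \<omega>: "\<omega> \<in> space M" and n: "j \<omega> \<le> N"
      then have "Y (g (j \<omega>)) \<omega> < C (j \<omega>) \<omega>"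
        using j(2)[of \<omega>] by (simp add: Q_def)
      then show "- W (j \<omega>) \<omega> \<le> proc_X M F (\<lambda>s t \<omega>. - U t s \<omega>) (grid_time h N (j \<omega>)) \<omega>"
        using W_rec[OF n, of \<omega>] by (simp add: g_def proc_X_flip[OF \<omega>])
    qed (use D2(3) st(2) \<rho> W_end W_int in \<open>auto simp: g_def\<close>)
    then show ?thesis
      using h(2) r_nonneg[of "ennreal h + ennreal h"] D2(2)
      by (simp add: dynkin_payoff_flip w_def)
  qed
  have "dynkin_saddle_point M F U \<epsilon> (\<lambda>\<omega>. g (i \<omega>)) (\<lambda>\<omega>. g (j \<omega>))"
    unfolding dynkin_saddle_point_def stopping_times_def
    using st lower upper by (fastforce)
  then show ?thesis
    by blast
qed

text \<open>The mesh used for the reactions is independent of the mesh behind the saddle point.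
  Near-minimizing reactions are obtained as near-maximizing ones for the flipped payoff.\<close>

lemma nash_equilibrium_exists:
  assumes \<epsilon>: "\<epsilon> > 0"
  shows "\<exists>\<rho> \<tau>. nash_equilibrium M F U (\<lambda>s t \<omega>. - U s t \<omega>) \<epsilon> \<rho> \<tau>"
proof -
  interpret flip: uniform_stopping_game M F "\<lambda>s t \<omega>. - U t s \<omega>" r
    by (rule uniform_stopping_game_flip)
  \<comment> \<open>The total error is \<delta> + 2 * (2 * \<delta>): each reaction loses \<delta>
    by near-optimality on the grid and less than \<delta> through the mesh.\<close>
  define \<delta> where "\<delta> = \<epsilon> / 5"
  have \<delta>: "\<delta> > 0"
    using \<epsilon> by (simp add: \<delta>_def)
  obtain \<rho>0 \<tau>0 where saddle: "dynkin_saddle_point M F U \<delta> \<rho>0 \<tau>0"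
    using dynkin_saddle_point_exists[OF \<delta>] by blast
  obtain h where h: "h > 0" "r (ennreal h) + r (ennreal h + ennreal h) < \<delta>"
    using small_mesh[OF \<delta>] by blast
  obtain \<beta>1 where \<beta>1: "near_maximizers M F U \<delta> h \<beta>1"
    using near_maximizers_exist[OF \<delta>] by blast
  obtain \<beta>2 where \<beta>2: "near_maximizers M F (\<lambda>s t \<omega>. - U t s \<omega>) \<delta> h \<beta>2"
    using flip.near_maximizers_exist[OF \<delta>] by blast
  have maps: "grid_map h \<beta>1 \<in> stopping_maps M F" "grid_map h \<beta>2 \<in> stopping_maps M F"
    using \<beta>1 \<beta>2 by (auto intro!: grid_map_stopping_map h(1) simp: near_maximizers_def Let_def)
  have "Y t \<omega> - 2 * \<delta> \<le> cexp t (\<lambda>\<omega>'. U (grid_map h \<beta>1 t \<omega>') t \<omega>') \<omega>"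
    if "t < \<infinity>" "\<omega> \<in> space M" for t \<omega>
    using grid_map_near_optimal[OF h(1) \<beta>1 that] h(2) by linarith
  moreover have "cexp t (\<lambda>\<omega>'. U t (grid_map h \<beta>2 t \<omega>') \<omega>') \<omega> \<le> X t \<omega> + 2 * \<delta>"
    if "t < \<infinity>" "\<omega> \<in> space M" for t \<omega>
    using flip.grid_map_near_optimal[OF h(1) \<beta>2 that] h(2) proc_Y_flip[OF that(2), of t]
      at_time.ce_minus[OF U_at_integrable[OF borel_measurable_const stopping_map_measurable[OF maps(2)]] that(2), of t t t]
    by linarith
  ultimately have "nash_equilibrium M F U (\<lambda>s t \<omega>. - U s t \<omega>) (\<delta> + 2 * (2 * \<delta>))
      (\<rho>0, grid_map h \<beta>1) (\<tau>0, grid_map h \<beta>2)"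
    using \<delta> by (intro nash_equilibrium_of_saddle_point saddle maps) auto
  then show ?thesis
    by (auto simp: \<delta>_def)
qed

end

theorem proposition3p3:
  fixes M :: "'a measure" and F :: "ennreal \<Rightarrow> 'a measure"
    and U :: "ennreal \<Rightarrow> ennreal \<Rightarrow> 'a \<Rightarrow> real" and r :: "ennreal \<Rightarrow> real"
  assumes game: "stopping_game M F U"
    and r_nonneg: "\<And>x. 0 \<le> r x"
    and r_bounded: "bounded (range r)"
    and r_mono: "mono r"
    and r_lim: "(r \<longlongrightarrow> 0) (at_right 0)"
    and r_zero: "r 0 = 0"
    and U_modulus: "\<And>s t s' t' \<omega>. \<omega> \<in> space M \<Longrightarrow>
      \<bar>U s t \<omega> - U s' t' \<omega>\<bar> \<le> r (time_dist s s' + time_dist t t')"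
  shows "(\<forall>\<epsilon>>0. \<forall>h>0. \<forall>\<rho>bar \<tau>bar \<rho>\<epsilon> \<tau>\<epsilon>.
            near_maximizers M F U \<epsilon> h \<rho>bar \<longrightarrow>
            near_minimizers M F U \<epsilon> h \<tau>bar \<longrightarrow>
            dynkin_saddle_point M F U \<epsilon> \<rho>\<epsilon> \<tau>\<epsilon> \<longrightarrow>
            (\<forall>\<rho>0\<in>stopping_times F. \<forall>\<omega>\<in>space M.
               proc_X M F U (\<rho>0 \<omega>) \<omega> >
               cond_exp_at M F \<rho>0 (\<lambda>\<omega>'. U (\<rho>0 \<omega>') (grid_map h \<tau>bar (\<rho>0 \<omega>') \<omega>') \<omega>') \<omega> - 2 * \<epsilon>) \<longrightarrow>
            (\<forall>\<tau>0\<in>stopping_times F. \<forall>\<omega>\<in>space M.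
               proc_Y M F U (\<tau>0 \<omega>) \<omega> <
               cond_exp_at M F \<tau>0 (\<lambda>\<omega>'. U (grid_map h \<rho>bar (\<tau>0 \<omega>') \<omega>') (\<tau>0 \<omega>') \<omega>') \<omega> + 2 * \<epsilon>) \<longrightarrow>
            nash_equilibrium M F U (\<lambda>s t \<omega>. - U s t \<omega>) (5 * \<epsilon>)
              (\<rho>\<epsilon>, grid_map h \<rho>bar) (\<tau>\<epsilon>, grid_map h \<tau>bar)) \<and>
         (\<forall>\<epsilon>>0. \<exists>\<rho> \<tau>. nash_equilibrium M F U (\<lambda>s t \<omega>. - U s t \<omega>) \<epsilon> \<rho> \<tau>)"
proof (intro conjI allI impI)
  interpret stopping_game M F U
    by (rule game)
  interpret uniform_stopping_game M F U r
    by unfold_locales (fact r_mono r_lim r_zero U_modulus)+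
  show "\<exists>\<rho> \<tau>. nash_equilibrium M F U (\<lambda>s t \<omega>. - U s t \<omega>) \<epsilon> \<rho> \<tau>" if "\<epsilon> > 0" for \<epsilon>
    using nash_equilibrium_exists[OF that] .
  fix \<epsilon> h :: real and \<rho>bar \<tau>bar \<rho>\<epsilon> \<tau>\<epsilon>
  assume \<epsilon>: "0 < \<epsilon>" and h: "0 < h"
    and \<rho>bar: "near_maximizers M F U \<epsilon> h \<rho>bar" and \<tau>bar: "near_minimizers M F U \<epsilon> h \<tau>bar"
    and saddle: "dynkin_saddle_point M F U \<epsilon> \<rho>\<epsilon> \<tau>\<epsilon>"
    and X: "\<forall>\<rho>0\<in>stopping_times F. \<forall>\<omega>\<in>space M.
       proc_X M F U (\<rho>0 \<omega>) \<omega> >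
       cond_exp_at M F \<rho>0 (\<lambda>\<omega>'. U (\<rho>0 \<omega>') (grid_map h \<tau>bar (\<rho>0 \<omega>') \<omega>') \<omega>') \<omega> - 2 * \<epsilon>"
    and Y: "\<forall>\<tau>0\<in>stopping_times F. \<forall>\<omega>\<in>space M.
       proc_Y M F U (\<tau>0 \<omega>) \<omega> <
       cond_exp_at M F \<tau>0 (\<lambda>\<omega>'. U (grid_map h \<rho>bar (\<tau>0 \<omega>') \<omega>') (\<tau>0 \<omega>') \<omega>') \<omega> + 2 * \<epsilon>"
  have maps: "grid_map h \<rho>bar \<in> stopping_maps M F" "grid_map h \<tau>bar \<in> stopping_maps M F"
    using \<rho>bar \<tau>bar
    by (auto intro!: grid_map_stopping_map h simp: near_maximizers_def near_minimizers_def Let_def)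
  \<comment> \<open>Constant stopping times turn the two smallness conditions on h into the
    fixed-time bounds with c = 2 * \<epsilon>.\<close>
  have const: "(\<lambda>_. t) \<in> stopping_times F" for t
    by (simp add: stopping_times_def stopping_time_const)
  have "cexp t (\<lambda>\<omega>'. U t (grid_map h \<tau>bar t \<omega>') \<omega>') \<omega> \<le> proc_X M F U t \<omega> + 2 * \<epsilon>"
    if "\<omega> \<in> space M" for t \<omega>
    using bspec[OF bspec[OF X const[of t]] that]
      cexp_pre_sigma[OF stopping_time_const U_at_integrable[OF borel_measurable_const
          stopping_map_measurable[OF maps(2)]] that, of t t t]
    by simp
  moreover have "proc_Y M F U t \<omega> - 2 * \<epsilon> \<le> cexp t (\<lambda>\<omega>'. U (grid_map h \<rho>bar t \<omega>') t \<omega>') \<omega>"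
    if "\<omega> \<in> space M" for t \<omega>
    using bspec[OF bspec[OF Y const[of t]] that]
      cexp_pre_sigma[OF stopping_time_const U_at_integrable[OF stopping_map_measurable[OF maps(1)]
          borel_measurable_const] that, of t t t]
    by simp
  ultimately have "nash_equilibrium M F U (\<lambda>s t \<omega>. - U s t \<omega>) (\<epsilon> + 2 * (2 * \<epsilon>))
      (\<rho>\<epsilon>, grid_map h \<rho>bar) (\<tau>\<epsilon>, grid_map h \<tau>bar)"
    using \<epsilon> by (intro nash_equilibrium_of_saddle_point saddle maps) auto
  then show "nash_equilibrium M F U (\<lambda>s t \<omega>. - U s t \<omega>) (5 * \<epsilon>)
      (\<rho>\<epsilon>, grid_map h \<rho>bar) (\<tau>\<epsilon>, grid_map h \<tau>bar)"
    by simp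
qed

end
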